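(* Let $F=\sum F_iX^i$ and $G=\sum G_iX^i$ be power series with coefficients in $\mathcal{O}_K$ with finite $\mathrm{wideg}(F)=n$ and $\mathrm{wideg}(G)=m$, such that $F_n$ and $G_m$ are units. (i) If $F,G\in\mathcal{O}_K^o[[X]]$ and $S(\mathbf{C}_p)$ is the supremum of $\phi$ on $\mathfrak{m}_{\mathbf{C}_p}$, then $S(\mathbf{C}_p)\le v_p(f_{n+m})$, where $f_1\mid f_2\mid\dots\mid f_{n+m}$ are the diagonal entries of the Smith normal form over $\mathcal{O}_K$ of the Sylvester matrix of $\mathscr{C}^o(F)$ and $\mathscr{C}^o(G)$. (ii) If $F,G\in\mathcal{O}_K^c[[X]]$, with $\mathrm{Lwideg}(F)=N$, $\mathrm{Lwideg}(G)=M$, and $S(\mathbf{C}_p)$ is the supremum of $\phi$ on $\mathcal{O}_{\mathbf{C}_p}$, then $S(\mathbf{C}_p)\le v_p(f'_{N+M})$, where $f'_1\mid\dots\mid f'_{N+M}$ are the diagonal entries of the Smith normal form over $\mathcal{O}_K$ of the Sylvester matrix of $\mathscr{C}^c(F)$ and $\mathscr{C}^c(G)$.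
   Context: $p$ is a prime; $K$ is a finite extension of $\mathbf{Q}_p$ with ring of integers $\mathcal{O}_K$ and maximal ideal $\mathfrak{m}_K$. $\mathbf{C}_p$ is the completion of $\overline{\mathbf{Q}}_p$ with valuation $v_p$, $v_p(p)=1$; $\mathcal{O}_{\mathbf{C}_p}$ and $\mathfrak{m}_{\mathbf{C}_p}$ are its closed and open unit discs. $\mathcal{O}_K^o[[X]]$ (resp. $\mathcal{O}_K^c[[X]]$) is the ring of power series in $\mathcal{O}_K[[X]]$ converging on $\mathfrak{m}_{\mathbf{C}_p}$ (resp. $\mathcal{O}_{\mathbf{C}_p}$). $\mathrm{wideg}(F)$ (resp. $\mathrm{Lwideg}(F)$) is the smallest (resp. largest) index $n$ with $v_p(F_n)=\min_i v_p(F_i)$. $\mathscr{C}^o(F)$ is the monic polynomial of degree $n=\mathrm{wideg}(F)$, with non-leading coefficients in $\mathfrak{m}_K$, such that $F=F_n\,\mathscr{C}^o(F)\,U$ with $U\in\mathcal{O}_K[[X]]^\times$. $\mathscr{C}^c(F)$ is the monic polynomial of degree $N=\mathrm{Lwideg}(F)$ such that $F=F_N\,\mathscr{C}^c(F)\,h$ with $h\in\mathcal{O}_K[[X]]^\times$ converging on $\mathcal{O}_{\mathbf{C}_p}$, having unit constant coefficient, all other coefficients non-units, and no zero on $\mathcal{O}_{\mathbf{C}_p}$. The Sylvester matrix of polynomials $A$ of degree $n$ and $B$ of degree $m$ is the $(n+m)\times(n+m)$ matrix whose rows are the coefficient vectors of $X^iA$ ($0\le i<m$) and $X^jB$ ($0\le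 j<n$). $\phi(x)=\min(v_p(F(x)),v_p(G(x)))$. *)

theory Defs
  imports
    "HOL-Analysis.Elementary_Metric_Spaces"
    "HOL-Computational_Algebra.Polynomial_FPS"
    "HOL-Library.Extended_Nat"
    "HOL-Library.Extended_Real"
    "Subresultants.Resultant_Prelim"
begin

section \<open>The field of p-adic complex numbers\<close>

text \<open>
  The library has no p-adic fields. The field \<open>C\<^sub>p\<close> is determined up to isometric isomorphism
  as a complete valued field in which the algebraic closure of the closure \<open>Q\<^sub>p\<close> of the
  rationals is dense. Results are stated for every type carrying such a structure.
\<close>

definition Qp :: "'c::{field_char_0, complete_space} set" where
  "Qp = closure (range of_rat)"

definition Qp_bar :: "'c::{field_char_0, complete_space} set" where
  "Qp_bar = {x. \<exists>q. q \<noteq> 0 \<and> (\<forall>i. coeff q i \<in> Qp) \<and> poly q x = 0}"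

text \<open>
  Multiplicativity and \<open>v p = 1\<close> with the ultrametric inequality force \<open>v\<close> to be the p-adic
  valuation on the rationals, so that \<open>Qp\<close> is their p-adic completion.
\<close>

locale padic_complex_field =
  fixes p :: nat and v :: "'c::{field_char_0, complete_space} \<Rightarrow> ereal"
  assumes prime_p: "prime p"
    and v_eq_infinity_iff: "v x = \<infinity> \<longleftrightarrow> x = 0"
    and v_not_minus_infinity: "v x \<noteq> -\<infinity>"
    and v_mult: "v (x * y) = v x + v y"
    and v_add: "min (v x) (v y) \<le> v (x + y)"
    and v_p: "v (of_nat p) = 1"
    and dist_v: "dist x y = (if x = y then 0 else real p powr (- real_of_ereal (v (x - y))))"
    and Qp_bar_alg_closed:
      "(\<And>i. coeff (q :: 'c poly) i \<in> Qp_bar) \<Longrightarrow> degree q > 0 \<Longrightarrow> \<exists>z \<in> Qp_bar. poly q z = 0"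
    and Qp_bar_dense: "closure Qp_bar = (UNIV :: 'c set)"

text \<open>A finite extension of \<open>Qp\<close>, as a subfield of the ambient \<open>C\<^sub>p\<close>.\<close>

definition finite_extension_Qp :: "'c::{field_char_0, complete_space} set \<Rightarrow> bool" where
  "finite_extension_Qp K \<longleftrightarrow>
     Qp \<subseteq> K \<and>
     (\<forall>x\<in>K. \<forall>y\<in>K. x - y \<in> K \<and> x * y \<in> K) \<and> (\<forall>x\<in>K. inverse x \<in> K) \<and>
     (\<exists>B. finite B \<and> B \<subseteq> K \<and>
        (\<forall>x\<in>K. \<exists>c. (\<forall>b\<in>B. c b \<in> Qp) \<and> x = (\<Sum>b\<in>B. c b * b)))"

text \<open>With \<open>K = UNIV\<close> the next two sets are the closed and the open unit disc of \<open>C\<^sub>p\<close>.\<close>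

definition integers_of :: "('c \<Rightarrow> ereal) \<Rightarrow> 'c set \<Rightarrow> 'c set" where
  "integers_of v K = {x\<in>K. 0 \<le> v x}"

definition max_ideal_of :: "('c \<Rightarrow> ereal) \<Rightarrow> 'c set \<Rightarrow> 'c set" where
  "max_ideal_of v K = {x\<in>K. 0 < v x}"

definition units_in :: "'a::comm_monoid_mult set \<Rightarrow> 'a set" where
  "units_in R = {u\<in>R. \<exists>w\<in>R. u * w = 1}"


section \<open>Power series\<close>

definition fps_over :: "'c set \<Rightarrow> 'c::zero fps set" where
  "fps_over R = {F. \<forall>i. fps_nth F i \<in> R}"

text \<open>
  The library's \<open>eval_fps\<close> is confined to real normed algebras, hence the plain sum here.
\<close>

definition fps_value :: "'c::{field_char_0, complete_space} fps \<Rightarrow> 'c \<Rightarrow> 'c" where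
  "fps_value F x = (\<Sum>i. fps_nth F i * x ^ i)"

definition fps_over_conv ::
  "'c set \<Rightarrow> 'c set \<Rightarrow> 'c::{field_char_0, complete_space} fps set" where
  "fps_over_conv R D = {F \<in> fps_over R. \<forall>x\<in>D. summable (\<lambda>i. fps_nth F i * x ^ i)}"

definition fps_o :: "('c \<Rightarrow> ereal) \<Rightarrow> 'c set \<Rightarrow> 'c::{field_char_0, complete_space} fps set" where
  "fps_o v K = fps_over_conv (integers_of v K) (max_ideal_of v UNIV)"

definition fps_c :: "('c \<Rightarrow> ereal) \<Rightarrow> 'c set \<Rightarrow> 'c::{field_char_0, complete_space} fps set" where
  "fps_c v K = fps_over_conv (integers_of v K) (integers_of v UNIV)"

definition min_indices :: "('c::zero \<Rightarrow> ereal) \<Rightarrow> 'c fps \<Rightarrow> nat set" where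
  "min_indices v F = {n. \<forall>i. v (fps_nth F n) \<le> v (fps_nth F i)}"

definition wideg :: "('c::zero \<Rightarrow> ereal) \<Rightarrow> 'c fps \<Rightarrow> enat" where
  "wideg v F = (if min_indices v F = {} then \<infinity> else enat (LEAST n. n \<in> min_indices v F))"

definition Lwideg :: "('c::zero \<Rightarrow> ereal) \<Rightarrow> 'c fps \<Rightarrow> enat" where
  "Lwideg v F =
     (if min_indices v F = {} \<or> infinite (min_indices v F) then \<infinity>
      else enat (Max (min_indices v F)))"

definition weierstrass_o ::
  "('c \<Rightarrow> ereal) \<Rightarrow> 'c set \<Rightarrow> 'c::{field_char_0, complete_space} fps \<Rightarrow> 'c poly" where
  "weierstrass_o v K F = (THE P.
     wideg v F = enat (degree P) \<and> lead_coeff P = 1 \<and>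
     (\<forall>i<degree P. coeff P i \<in> max_ideal_of v K) \<and>
     (\<exists>U \<in> units_in (fps_over (integers_of v K)).
        F = fps_const (fps_nth F (degree P)) * fps_of_poly P * U))"

definition weierstrass_c ::
  "('c \<Rightarrow> ereal) \<Rightarrow> 'c set \<Rightarrow> 'c::{field_char_0, complete_space} fps \<Rightarrow> 'c poly" where
  "weierstrass_c v K F = (THE P.
     Lwideg v F = enat (degree P) \<and> lead_coeff P = 1 \<and>
     (\<forall>i. coeff P i \<in> integers_of v K) \<and>
     (\<exists>h \<in> units_in (fps_over (integers_of v K)).
        h \<in> fps_c v K \<and>
        fps_nth h 0 \<in> units_in (integers_of v K) \<and>
        (\<forall>i>0. fps_nth h i \<notin> units_in (integers_of v K)) \<and>
        (\<forall>x \<in> integers_of v UNIV. fps_value h x \<noteq> 0) \<and>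
        F = fps_const (fps_nth F (degree P)) * fps_of_poly P * h))"

definition phi ::
  "('c \<Rightarrow> ereal) \<Rightarrow> 'c::{field_char_0, complete_space} fps \<Rightarrow> 'c fps \<Rightarrow> 'c \<Rightarrow> ereal" where
  "phi v F G x = min (v (fps_value F x)) (v (fps_value G x))"


section \<open>Smith normal form\<close>

definition mat_over :: "'a set \<Rightarrow> nat \<Rightarrow> nat \<Rightarrow> 'a mat set" where
  "mat_over R k l = {A \<in> carrier_mat k l. \<forall>i<k. \<forall>j<l. A $$ (i, j) \<in> R}"

definition GL_over :: "'a::semiring_1 set \<Rightarrow> nat \<Rightarrow> 'a mat set" where
  "GL_over R k = {P \<in> mat_over R k k. \<exists>P' \<in> mat_over R k k. P * P' = 1\<^sub>m k \<and> P' * P = 1\<^sub>m k}"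

text \<open>
  A Smith normal form is unique only up to units of \<open>R\<close>, so it is a relation between matrices.
\<close>

definition is_smith_normal_form :: "'a::semiring_1 set \<Rightarrow> 'a mat \<Rightarrow> 'a mat \<Rightarrow> bool" where
  "is_smith_normal_form R A D \<longleftrightarrow>
     D \<in> mat_over R (dim_row A) (dim_col A) \<and> diagonal_mat D \<and>
     (\<forall>i. Suc i < min (dim_row A) (dim_col A) \<longrightarrow>
        (\<exists>r\<in>R. D $$ (Suc i, Suc i) = D $$ (i, i) * r)) \<and>
     (\<exists>P \<in> GL_over R (dim_row A). \<exists>Q \<in> GL_over R (dim_col A). D = P * A * Q)"

text \<open>
  Diagonal entries are counted from 1. The value \<open>1\<close> at \<open>0\<close> serves as the last diagonal entry
  of the empty matrix, which is the Sylvester matrix of two constant polynomials.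
\<close>

definition diag_entry :: "'a::one mat \<Rightarrow> nat \<Rightarrow> 'a" where
  "diag_entry D k = (if k = 0 then 1 else D $$ (k - 1, k - 1))"

end

theory Submission
  imports Defs
begin

text \<open>
  Write \<open>|x| = p\<^sup>-\<^sup>v\<^sup>(\<^sup>x\<^sup>)\<close>. Weierstrass preparation writes \<open>F\<close> as a unit constant times \<open>P U\<close>, where \<open>P\<close> is
  the Weierstrass polynomial of \<open>F\<close> and \<open>|U(x)| = 1\<close> on the whole disc, so \<open>F\<close> and \<open>P\<close> have the
  same valuation at each point of the disc; likewise \<open>G\<close> and its polynomial \<open>P'\<close>
  (\<open>v_value_open_disc\<close>, \<open>v_value_closed_disc\<close>). It remains to bound
  \<open>r = max |P(x)| |P'(x)|\<close> from below for the two polynomials, which is linear algebra over the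
  integers of \<open>C\<^sub>p\<close>. Let \<open>S\<close> be the Sylvester matrix, of size \<open>k\<close>, and \<open>w = (x\<^sup>k\<^sup>-\<^sup>1, \<dots>, x, 1)\<close>. The
  entries of \<open>S w\<close> are the \<open>x\<^sup>i P(x)\<close> and \<open>x\<^sup>j P'(x)\<close>, all of absolute value at most \<open>r\<close>. If
  \<open>D = A S B\<close> is a Smith normal form, then \<open>y = B\<^sup>-\<^sup>1 w\<close> has integral entries, and one of them is a
  unit because \<open>w = B y\<close> has an entry \<open>1\<close>. Since \<open>D y = A (S w)\<close> has entries of absolute value at
  most \<open>r\<close>, the diagonal entry of \<open>D\<close> facing the unit entry of \<open>y\<close> is bounded by \<open>r\<close>, and hence so
  is the last diagonal entry, a multiple of it (\<open>smith_last_entry_small\<close>,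
  \<open>sylvester_smith_bound\<close>).

  The Weierstrass polynomials are definite descriptions, so most of the work is to show that they
  exist and are unique. Existence needs the completeness of the ring of integers of \<open>K\<close>, that is,
  that \<open>K\<close> is closed in \<open>C\<^sub>p\<close>; this follows by induction on a spanning set
  (\<open>closed_Qp_span\<close>). Both preparation theorems then come out of one Hensel iteration
  (\<open>factorization_near_polynomial\<close>): a series that is close to a monic polynomial \<open>Q\<close>, in a
  ring of series where one can divide approximately by \<open>Q\<close>, is a product of a monic polynomial and
  a series close to \<open>1\<close>. On the open disc \<open>Q = X\<^sup>n\<close>, after division of \<open>F\<close> by the unit series that
  starts at \<open>F\<^sub>n\<close>; on the closed disc \<open>Q\<close> is the truncation of \<open>F / F\<^sub>N\<close> after degree \<open>N\<close>.

  For uniqueness, two factorizations \<open>P U = P' U'\<close> give \<open>P - P' = P' d\<close> with \<open>d = U'/U - 1\<close>. The left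
  side has no coefficients in degrees \<open>\<ge> deg P'\<close>, so every coefficient of \<open>d\<close> is a combination of the
  next \<open>deg P'\<close> ones. This forces \<open>d = 0\<close>: on the open disc because the weights lie in the maximal
  ideal, on the closed disc because the coefficients of \<open>d\<close> tend to zero
  (\<open>distinguished_quotient_zero\<close>, \<open>monic_quotient_zero\<close>).
\<close>

section \<open>The p-adic absolute value\<close>

context padic_complex_field
begin

text \<open>
  The real absolute value attached to \<open>v\<close>. Using it instead of \<open>v\<close> avoids extended reals, and
  \<open>dist\<close> makes the completeness of the type available.
\<close>

definition nrm :: "'c \<Rightarrow> real" where
  "nrm x = dist x 0"

lemma nrm_alt: "nrm x = (if x = 0 then 0 else real p powr (- real_of_ereal (v x)))"
  unfolding nrm_def dist_v by simp

lemma dist_eq_nrm: "dist x y = nrm (x - y)"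
  unfolding nrm_alt dist_v by simp

lemma p_gt_1: "real p > 1"
  using prime_gt_1_nat[OF prime_p] by simp

lemma v_finite: "x \<noteq> 0 \<Longrightarrow> \<exists>r. v x = ereal r"
  using v_eq_infinity_iff[of x] v_not_minus_infinity[of x] by (cases "v x") auto

lemma v_zero [simp]: "v 0 = \<infinity>"
  by (simp add: v_eq_infinity_iff)

lemma nrm_nonneg [simp]: "0 \<le> nrm x"
  by (simp add: nrm_def)

lemma nrm_eq_0_iff [simp]: "nrm x = 0 \<longleftrightarrow> x = 0"
  by (simp add: nrm_def)

lemma nrm_zero [simp]: "nrm 0 = 0"
  by simp

lemma nrm_le_iff: "nrm x \<le> nrm y \<longleftrightarrow> v y \<le> v x"
proof (cases "x = 0 \<or> y = 0")
  case True
  then show ?thesis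
    using v_eq_infinity_iff[of x] p_gt_1 by (auto simp: nrm_alt)
next
  case False
  then obtain r s where "v x = ereal r" "v y = ereal s"
    using v_finite by metis
  with False p_gt_1 show ?thesis
    by (simp add: nrm_alt)
qed

lemma nrm_mult: "nrm (x * y) = nrm x * nrm y"
proof (cases "x = 0 \<or> y = 0")
  case False
  then obtain r s where "v x = ereal r" "v y = ereal s"
    using v_finite by metis
  with False p_gt_1 show ?thesis
    by (simp add: nrm_alt v_mult powr_add[symmetric])
qed auto

lemma v_one [simp]: "v 1 = 0"
proof -
  obtain r where r: "v 1 = ereal r"
    using v_finite[of 1] by auto
  have "v 1 = v 1 + v 1"
    using v_mult[of 1 1] by simp
  with r show ?thesis by simp
qed

lemma nrm_one [simp]: "nrm 1 = 1"
  using p_gt_1 by (simp add: nrm_alt)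

lemma nrm_le_1_iff: "nrm x \<le> 1 \<longleftrightarrow> 0 \<le> v x"
  using nrm_le_iff[of x 1] by simp

lemma nrm_less_1_iff: "nrm x < 1 \<longleftrightarrow> 0 < v x"
  using nrm_le_iff[of 1 x] by (auto simp: not_le[symmetric])

lemma nrm_add: "nrm (x + y) \<le> max (nrm x) (nrm y)"
proof -
  have "nrm (x + y) \<le> nrm x \<or> nrm (x + y) \<le> nrm y"
    unfolding nrm_le_iff using v_add[of x y] by (auto simp: min_def split: if_splits)
  then show ?thesis by auto
qed

lemma nrm_minus_one: "nrm (-1) = 1"
proof -
  have "nrm (-1) * nrm (-1) = 1"
    unfolding nrm_mult[symmetric] by simp
  then have "nrm (-1) = 1 \<or> nrm (-1) = -1"
    unfolding power2_eq_square[symmetric] power2_eq_1_iff .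
  then show ?thesis
    using nrm_nonneg[of "-1"] by linarith
qed

lemma nrm_minus [simp]: "nrm (- x) = nrm x"
  using nrm_mult[of "-1" x] nrm_minus_one by simp

lemma nrm_minus_commute: "nrm (x - y) = nrm (y - x)"
  using nrm_minus[of "x - y"] by simp

lemma nrm_diff: "nrm (x - y) \<le> max (nrm x) (nrm y)"
  using nrm_add[of x "- y"] by simp

lemma nrm_add_le: "nrm x \<le> r \<Longrightarrow> nrm y \<le> r \<Longrightarrow> nrm (x + y) \<le> r"
  using nrm_add[of x y] by simp

lemma nrm_diff_le: "nrm x \<le> r \<Longrightarrow> nrm y \<le> r \<Longrightarrow> nrm (x - y) \<le> r"
  using nrm_diff[of x y] by simp

lemma nrm_mult_le: "nrm x \<le> r \<Longrightarrow> nrm y \<le> s \<Longrightarrow> 0 \<le> r \<Longrightarrow> nrm (x * y) \<le> r * s"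
  unfolding nrm_mult by (intro mult_mono) auto

lemma nrm_sum_le: "0 \<le> r \<Longrightarrow> (\<And>i. i \<in> A \<Longrightarrow> nrm (f i) \<le> r) \<Longrightarrow> nrm (\<Sum>i\<in>A. f i) \<le> r"
  by (induction A rule: infinite_finite_induct) (auto intro: nrm_add_le)

text \<open>
  The ultrametric principle that the larger term dominates.
\<close>

lemma nrm_eq_of_close: "nrm (x - y) < nrm y \<Longrightarrow> nrm x = nrm y"
  using nrm_add[of "x - y" y] nrm_diff[of "x" "x - y"] by (auto simp: max_def split: if_splits)

lemma nrm_inverse: "nrm (inverse x) = inverse (nrm x)"
proof (cases "x = 0")
  case False
  then have "nrm x * nrm (inverse x) = 1"
    by (simp add: nrm_mult[symmetric])
  then show ?thesis
    by (metis inverse_unique)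
qed simp

lemma nrm_power: "nrm (x ^ i) = nrm x ^ i"
  by (induction i) (auto simp: nrm_mult)

section \<open>Continuity of the field operations\<close>

lemma tendsto_iff_nrm: "(X \<longlonglongrightarrow> l) \<longleftrightarrow> ((\<lambda>j. nrm (X j - l)) \<longlonglongrightarrow> 0)"
  unfolding tendsto_dist_iff[of X l] dist_eq_nrm ..

text \<open>
  The type class only provides a metric, so the continuity of the field operations has to be derived
  from the ultrametric inequality.
\<close>

lemma tendsto_nrm_comparison:
  assumes "f \<longlonglongrightarrow> 0" "\<forall>\<^sub>F j in sequentially. nrm (X j - l) \<le> f j"
  shows "X \<longlonglongrightarrow> l"
  unfolding tendsto_iff_nrm
  by (rule tendsto_sandwich[OF _ assms(2) tendsto_const assms(1)]) simp

lemma tendsto_diff_nrm: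
  fixes X :: "nat \<Rightarrow> 'c"
  assumes "X \<longlonglongrightarrow> x" "Y \<longlonglongrightarrow> y"
  shows "(\<lambda>j. X j - Y j) \<longlonglongrightarrow> x - y"
proof -
  have "(\<lambda>j. nrm (X j - x) + nrm (Y j - y)) \<longlonglongrightarrow> 0"
    using tendsto_add[OF assms[unfolded tendsto_iff_nrm]] by simp
  then show ?thesis
  proof (rule tendsto_nrm_comparison, intro always_eventually allI)
    fix j
    have "nrm ((X j - x) - (Y j - y)) \<le> nrm (X j - x) + nrm (Y j - y)"
      by (rule nrm_diff_le) auto
    then show "nrm (X j - Y j - (x - y)) \<le> nrm (X j - x) + nrm (Y j - y)"
      by (simp add: algebra_simps)
  qed
qed

lemma tendsto_mult_nrm:
  fixes X :: "nat \<Rightarrow> 'c"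
  assumes "X \<longlonglongrightarrow> x" "Y \<longlonglongrightarrow> y"
  shows "(\<lambda>j. X j * Y j) \<longlonglongrightarrow> x * y"
proof -
  let ?a = "\<lambda>j. nrm (X j - x)" and ?b = "\<lambda>j. nrm (Y j - y)"
  have "(\<lambda>j. ?a j * ?b j + (?a j * nrm y + nrm x * ?b j)) \<longlonglongrightarrow> 0 * 0 + (0 * nrm y + nrm x * 0)"
    using assms[unfolded tendsto_iff_nrm] by (intro tendsto_intros)
  then have "(\<lambda>j. ?a j * ?b j + (?a j * nrm y + nrm x * ?b j)) \<longlonglongrightarrow> 0"
    by simp
  then show ?thesis
  proof (rule tendsto_nrm_comparison, intro always_eventually allI)
    fix j
    \<comment> \<open>Expanded around the limits, every summand visibly tends to zero.\<close>
    have eq: "X j * Y j - x * y = (X j - x) * (Y j - y) + ((X j - x) * y + x * (Y j - y))"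
      by (simp add: algebra_simps)
    show "nrm (X j * Y j - x * y) \<le> ?a j * ?b j + (?a j * nrm y + nrm x * ?b j)"
      unfolding eq by (intro nrm_add_le) (auto simp: nrm_mult intro: add_increasing add_increasing2)
  qed
qed

lemma tendsto_inverse_nrm:
  fixes X :: "nat \<Rightarrow> 'c"
  assumes "X \<longlonglongrightarrow> x" "x \<noteq> 0"
  shows "(\<lambda>j. inverse (X j)) \<longlonglongrightarrow> inverse x"
proof -
  have X: "(\<lambda>j. nrm (X j - x)) \<longlonglongrightarrow> 0"
    using assms(1) by (simp add: tendsto_iff_nrm)
  have "(\<lambda>j. nrm (X j - x) * inverse (nrm x * nrm x)) \<longlonglongrightarrow> 0"
    using tendsto_mult_left_zero[OF X] .
  moreover have "\<forall>\<^sub>F j in sequentially. nrm (X j - x) < nrm x"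
    using X assms(2) by (intro order_tendstoD(2)[OF X]) (simp add: order_less_le)
  then have "\<forall>\<^sub>F j in sequentially.
      nrm (inverse (X j) - inverse x) \<le> nrm (X j - x) * inverse (nrm x * nrm x)"
  proof eventually_elim
    case (elim j)
    have nX: "nrm (X j) = nrm x"
      by (rule nrm_eq_of_close[OF elim])
    then have "X j \<noteq> 0"
      using assms(2) nrm_eq_0_iff by metis
    then have "inverse (X j) - inverse x = (x - X j) * (inverse (X j) * inverse x)"
      using assms(2) by (simp add: field_simps)
    then show ?case
      by (simp add: nrm_mult nrm_inverse nX nrm_minus_commute[of x])
  qed
  ultimately show ?thesis
    by (rule tendsto_nrm_comparison)
qed

section \<open>Finite-dimensional spaces over the p-adic numbers\<close>

lemma Cauchy_nrm: "Cauchy X \<longleftrightarrow> (\<forall>e>0. \<exists>M. \<forall>j\<ge>M. \<forall>k\<ge>M. nrm (X j - X k) < e)"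
  unfolding Cauchy_def dist_eq_nrm ..

lemma Qp_lim: "x \<in> Qp \<longleftrightarrow> (\<exists>X. (\<forall>j. X j \<in> range of_rat) \<and> X \<longlonglongrightarrow> (x::'c))"
  unfolding Qp_def closure_sequential ..

lemma closed_Qp: "closed (Qp :: 'c set)"
  unfolding Qp_def by simp

lemma of_rat_in_Qp: "of_rat q \<in> (Qp :: 'c set)"
  unfolding Qp_def by (rule subsetD[OF closure_subset]) simp

text \<open>
  The closure of the rationals is a field by continuity of the field operations.
\<close>

lemma Qp_diff:
  assumes "x \<in> Qp" "y \<in> Qp"
  shows "x - y \<in> (Qp :: 'c set)"
proof -
  obtain X where X: "\<And>j. X j \<in> range of_rat" "X \<longlonglongrightarrow> x"
    using assms(1) unfolding Qp_lim by blast
  obtain Y where Y: "\<And>j. Y j \<in> range of_rat" "Y \<longlonglongrightarrow> y"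
    using assms(2) unfolding Qp_lim by blast
  have "X j - Y j \<in> range of_rat" for j
    using X(1)[of j] Y(1)[of j] by (auto simp flip: of_rat_diff)
  with tendsto_diff_nrm[OF X(2) Y(2)] show ?thesis
    unfolding Qp_lim by (intro exI[of _ "\<lambda>j. X j - Y j"]) simp
qed

lemma Qp_mult:
  assumes "x \<in> Qp" "y \<in> Qp"
  shows "x * y \<in> (Qp :: 'c set)"
proof -
  obtain X where X: "\<And>j. X j \<in> range of_rat" "X \<longlonglongrightarrow> x"
    using assms(1) unfolding Qp_lim by blast
  obtain Y where Y: "\<And>j. Y j \<in> range of_rat" "Y \<longlonglongrightarrow> y"
    using assms(2) unfolding Qp_lim by blast
  have "X j * Y j \<in> range of_rat" for j
    using X(1)[of j] Y(1)[of j] by (auto simp flip: of_rat_mult)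
  with tendsto_mult_nrm[OF X(2) Y(2)] show ?thesis
    unfolding Qp_lim by (intro exI[of _ "\<lambda>j. X j * Y j"]) simp
qed

lemma Qp_inverse:
  assumes "x \<in> Qp"
  shows "inverse x \<in> (Qp :: 'c set)"
proof (cases "x = 0")
  case False
  obtain X where X: "\<And>j. X j \<in> range of_rat" "X \<longlonglongrightarrow> x"
    using assms unfolding Qp_lim by blast
  have "inverse (X j) \<in> range of_rat" for j
    using X(1)[of j] by (auto simp flip: of_rat_inverse)
  with tendsto_inverse_nrm[OF X(2) False] show ?thesis
    unfolding Qp_lim by (intro exI[of _ "\<lambda>j. inverse (X j)"]) simp
qed (use assms in simp)

lemma Qp_zero: "0 \<in> (Qp :: 'c set)" and Qp_one: "1 \<in> (Qp :: 'c set)"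
  using of_rat_in_Qp[of 0] of_rat_in_Qp[of 1] by simp_all

lemma Qp_uminus: "x \<in> Qp \<Longrightarrow> - x \<in> (Qp :: 'c set)"
  using Qp_diff[OF Qp_zero, of x] by simp

definition Qp_span :: "'c set \<Rightarrow> 'c set" where
  "Qp_span B = {x. \<exists>c. (\<forall>b\<in>B. c b \<in> Qp) \<and> x = (\<Sum>b\<in>B. c b * b)}"

lemma Qp_span_diff:
  assumes "x \<in> Qp_span B" "y \<in> Qp_span B"
  shows "x - y \<in> Qp_span B"
proof -
  obtain c d where "\<forall>b\<in>B. c b \<in> Qp" "x = (\<Sum>b\<in>B. c b * b)" "\<forall>b\<in>B. d b \<in> Qp" "y = (\<Sum>b\<in>B. d b * b)"
    using assms unfolding Qp_span_def by blast
  then show ?thesis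
    unfolding Qp_span_def
    by (auto intro!: exI[of _ "\<lambda>b. c b - d b"] Qp_diff simp: sum_subtractf algebra_simps)
qed

lemma Qp_span_scale:
  assumes "a \<in> Qp" "x \<in> Qp_span B"
  shows "a * x \<in> Qp_span B"
proof -
  obtain c where "\<forall>b\<in>B. c b \<in> Qp" "x = (\<Sum>b\<in>B. c b * b)"
    using assms unfolding Qp_span_def by blast
  with assms(1) show ?thesis
    unfolding Qp_span_def
    by (auto intro!: exI[of _ "\<lambda>b. a * c b"] Qp_mult simp: sum_distrib_left algebra_simps)
qed

lemma Qp_span_insert:
  assumes "finite B" "b \<notin> B"
  shows "x \<in> Qp_span (insert b B) \<longleftrightarrow> (\<exists>a\<in>Qp. \<exists>w\<in>Qp_span B. x = a * b + w)"
proof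
  assume "x \<in> Qp_span (insert b B)"
  then obtain c where c: "\<forall>b\<in>insert b B. c b \<in> Qp" "x = (\<Sum>b\<in>insert b B. c b * b)"
    unfolding Qp_span_def by blast
  then have "c b \<in> Qp" "(\<Sum>b\<in>B. c b * b) \<in> Qp_span B" "x = c b * b + (\<Sum>b\<in>B. c b * b)"
    using assms by (auto simp: Qp_span_def)
  then show "\<exists>a\<in>Qp. \<exists>w\<in>Qp_span B. x = a * b + w" by blast
next
  assume "\<exists>a\<in>Qp. \<exists>w\<in>Qp_span B. x = a * b + w"
  then obtain a c where a: "a \<in> Qp" and c: "\<forall>b\<in>B. c b \<in> Qp" "x = a * b + (\<Sum>b\<in>B. c b * b)"
    unfolding Qp_span_def by blast
  have "(\<Sum>b'\<in>B. (c(b := a)) b' * b') = (\<Sum>b\<in>B. c b * b)"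
    using assms by (intro sum.cong) auto
  then have "x = (\<Sum>b'\<in>insert b B. (c(b := a)) b' * b')"
    using assms c by (simp del: fun_upd_apply) simp
  moreover have "\<forall>b'\<in>insert b B. (c(b := a)) b' \<in> Qp"
    using a c by simp
  ultimately show "x \<in> Qp_span (insert b B)"
    unfolding Qp_span_def by blast
qed

text \<open>
  A finite-dimensional \<open>Qp\<close>-subspace is complete. If the new generator \<open>b\<close> lies at distance
  \<open>\<delta> > 0\<close> from the span \<open>V\<close> of the others, then \<open>|a| \<delta> \<le> |a b + w|\<close> for \<open>w \<in> V\<close>. So in a convergent
  sequence \<open>a\<^sub>j b + w\<^sub>j\<close> the coefficients \<open>a\<^sub>j\<close> are Cauchy and converge in \<open>Qp\<close>, whence the \<open>w\<^sub>j\<close> converge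
  too, in \<open>V\<close> by induction.
\<close>

lemma closed_Qp_span:
  assumes "finite B"
  shows "closed (Qp_span B)"
  using assms
proof (induction B rule: finite_induct)
  case empty
  have "Qp_span {} = {0}"
    unfolding Qp_span_def by auto
  then show ?case by simp
next
  case (insert b B)
  note ins = Qp_span_insert[OF insert.hyps]
  show ?case
  proof (cases "b \<in> Qp_span B")
    case True
    have "Qp_span (insert b B) = Qp_span B"
    proof (intro equalityI subsetI)
      fix x assume "x \<in> Qp_span (insert b B)"
      then obtain a w where aw: "a \<in> Qp" "w \<in> Qp_span B" "x = a * b + w"
        unfolding ins by blast
      have "w - (- a) * b \<in> Qp_span B"
        by (intro Qp_span_diff Qp_span_scale Qp_uminus aw True)
      then show "x \<in> Qp_span B" using aw by (simp add: algebra_simps)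
    next
      fix x assume "x \<in> Qp_span B"
      then show "x \<in> Qp_span (insert b B)"
        unfolding ins using Qp_zero by (intro bexI[of _ 0] bexI[of _ x]) auto
    qed
    with insert.IH show ?thesis by simp
  next
    case False
    \<comment> \<open>Here the closedness of the smaller span enters: \<open>b\<close> has positive distance from it.\<close>
    then obtain \<delta> where \<delta>: "\<delta> > 0" "\<And>w. w \<in> Qp_span B \<Longrightarrow> \<delta> \<le> nrm (b - w)"
      using insert.IH unfolding closed_def open_dist dist_eq_nrm
      by (metis ComplD ComplI linorder_not_le nrm_minus_commute)
    have lower: "nrm a * \<delta> \<le> nrm (a * b + w)" if aw: "a \<in> Qp" "w \<in> Qp_span B" for a w
    proof (cases "a = 0")
      case a: False
      have "(- inverse a) * w \<in> Qp_span B"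
        by (intro Qp_span_scale Qp_uminus Qp_inverse aw)
      then have "nrm a * \<delta> \<le> nrm a * nrm (b - (- inverse a) * w)"
        by (intro mult_left_mono \<delta>) auto
      also have "\<dots> = nrm (a * b + w)"
        using a unfolding nrm_mult[symmetric] by (intro arg_cong[of _ _ nrm]) (simp add: field_simps)
      finally show ?thesis .
    qed simp
    show ?thesis
      unfolding closed_sequential_limits
    proof (intro allI impI, elim conjE)
      fix z l
      assume z: "\<forall>j. z j \<in> Qp_span (insert b B)" and lim: "z \<longlonglongrightarrow> l"
      have "\<forall>j. \<exists>a w. a \<in> Qp \<and> w \<in> Qp_span B \<and> z j = a * b + w"
        using z unfolding ins by blast
      then obtain a w where a: "\<And>j. a j \<in> Qp" and w: "\<And>j. w j \<in> Qp_span B"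
        and zj: "\<And>j. z j = a j * b + w j"
        by metis
      have dz: "nrm (a j - a k) * \<delta> \<le> nrm (z j - z k)" for j k
        using lower[OF Qp_diff[OF a a] Qp_span_diff[OF w w], of j k j k]
        by (simp add: zj algebra_simps)
      have "Cauchy a"
        unfolding Cauchy_nrm
      proof (intro allI impI)
        fix e :: real assume "e > 0"
        then have "e * \<delta> > 0" using \<delta> by simp
        then obtain M where M: "\<And>j k. j \<ge> M \<Longrightarrow> k \<ge> M \<Longrightarrow> nrm (z j - z k) < e * \<delta>"
          using LIMSEQ_imp_Cauchy[OF lim] unfolding Cauchy_nrm by meson
        have "nrm (a j - a k) < e" if "j \<ge> M" "k \<ge> M" for j k
          using le_less_trans[OF dz M[OF that]] \<delta> by simp
        then show "\<exists>M. \<forall>j\<ge>M. \<forall>k\<ge>M. nrm (a j - a k) < e" by blast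
      qed
      then obtain a' where a': "a \<longlonglongrightarrow> a'"
        using Cauchy_convergent convergent_def by blast
      have "a' \<in> Qp"
        using closed_sequentially[OF closed_Qp a a'] .
      have "w = (\<lambda>j. z j - a j * b)"
        by (simp add: zj)
      then have "w \<longlonglongrightarrow> l - a' * b"
        using tendsto_diff_nrm[OF lim tendsto_mult_nrm[OF a' tendsto_const]] by simp
      then have "l - a' * b \<in> Qp_span B"
        using closed_sequentially[OF insert.IH w] by simp
      then show "l \<in> Qp_span (insert b B)"
        unfolding ins using \<open>a' \<in> Qp\<close> by (intro bexI[of _ a'] bexI[of _ "l - a' * b"]) auto
    qed
  qed
qed

section \<open>Bounds on the Gauss norm\<close>

text \<open>
  The Gauss norm of \<open>f\<close> is at most \<open>r\<close>. Stating the bound avoids a supremum that need not be finite.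
\<close>

definition gauss_le :: "real \<Rightarrow> 'c fps \<Rightarrow> bool" where
  "gauss_le r f \<longleftrightarrow> (\<forall>i. nrm (fps_nth f i) \<le> r)"

lemma gauss_leD: "gauss_le r f \<Longrightarrow> nrm (fps_nth f i) \<le> r"
  by (simp add: gauss_le_def)

lemma gauss_le_mono: "gauss_le r f \<Longrightarrow> r \<le> s \<Longrightarrow> gauss_le s f"
  unfolding gauss_le_def by (meson order_trans)

lemma gauss_le_add: "gauss_le r f \<Longrightarrow> gauss_le r g \<Longrightarrow> gauss_le r (f + g)"
  unfolding gauss_le_def by (auto intro: nrm_add_le)

lemma gauss_le_diff: "gauss_le r f \<Longrightarrow> gauss_le r g \<Longrightarrow> gauss_le r (f - g)"
  unfolding gauss_le_def by (auto intro: nrm_diff_le)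

lemma gauss_le_nonneg: "gauss_le r f \<Longrightarrow> 0 \<le> r"
  unfolding gauss_le_def using nrm_nonneg order_trans by blast

lemma gauss_le_mult: "gauss_le r f \<Longrightarrow> gauss_le s g \<Longrightarrow> gauss_le (r * s) (f * g)"
  using gauss_le_nonneg[of r f] gauss_le_nonneg[of s g]
  unfolding gauss_le_def fps_mult_nth by (auto intro!: nrm_sum_le nrm_mult_le)

text \<open>
  Gives a uniform \<open>\<rho> < 1\<close> for finitely many elements of the maximal ideal; it is kept positive so that
  the powers of \<open>\<rho>\<close> can serve as radii.
\<close>

lemma finite_nrm_less_one:
  assumes "finite A" "\<And>i. i \<in> A \<Longrightarrow> g i < (1::real)"
  shows "\<exists>\<rho>. 0 < \<rho> \<and> \<rho> < 1 \<and> (\<forall>i\<in>A. g i \<le> \<rho>)"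
proof (intro exI conjI)
  let ?\<rho> = "Max (insert (1/2) (g ` A))"
  show "?\<rho> < 1" using assms by auto
  show "\<forall>i\<in>A. g i \<le> ?\<rho>" using assms by auto
  have "1/2 \<le> ?\<rho>" using assms by (intro Max_ge) auto
  then show "0 < ?\<rho>" by linarith
qed

section \<open>Convergent series\<close>

text \<open>
  A block of terms is no larger than its largest term, so null terms make the partial sums Cauchy.
\<close>

lemma summable_of_null:
  assumes "\<And>r. r > 0 \<Longrightarrow> \<exists>M. \<forall>i\<ge>M. nrm (a i) \<le> r"
  shows "summable a"
proof -
  have "Cauchy (\<lambda>k. \<Sum>i<k. a i)"
    unfolding Cauchy_nrm
  proof (intro allI impI)
    fix e :: real assume "e > 0"
    then obtain M where M: "\<And>i. i \<ge> M \<Longrightarrow> nrm (a i) \<le> e / 2"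
      using assms[of "e/2"] by auto
    have *: "nrm ((\<Sum>i<k. a i) - (\<Sum>i<j. a i)) \<le> e / 2" if "M \<le> j" "j \<le> k" for j k
    proof -
      have "(\<Sum>i<k. a i) - (\<Sum>i<j. a i) = (\<Sum>i\<in>{j..<k}. a i)"
        using that(2) by (metis atLeast0LessThan sum_diff_nat_ivl zero_le)
      then show ?thesis
        using \<open>e > 0\<close> that M by (simp only:, intro nrm_sum_le) auto
    qed
    have "nrm ((\<Sum>i<j. a i) - (\<Sum>i<k. a i)) < e" if "M \<le> j" "M \<le> k" for j k
      using *[of j k] *[of k j] that \<open>e > 0\<close> nrm_minus_commute[of "\<Sum>i<j. a i"]
      by (cases "j \<le> k") auto
    then show "\<exists>M. \<forall>j\<ge>M. \<forall>k\<ge>M. nrm ((\<Sum>i<j. a i) - (\<Sum>i<k. a i)) < e" by blast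
  qed
  then obtain l where "(\<lambda>k. \<Sum>i<k. a i) \<longlonglongrightarrow> l"
    using Cauchy_convergent convergent_def by blast
  then show ?thesis
    unfolding summable_def sums_def by blast
qed

lemma null_of_summable:
  assumes "summable a" "r > 0"
  shows "\<exists>M. \<forall>i\<ge>M. nrm (a i) \<le> r"
proof -
  obtain l where l: "(\<lambda>k. \<Sum>i<k. a i) \<longlonglongrightarrow> l"
    using assms(1) unfolding summable_def sums_def by blast
  have "(\<lambda>k. (\<Sum>i<Suc k. a i) - (\<Sum>i<k. a i)) \<longlonglongrightarrow> l - l"
    by (intro tendsto_diff_nrm l LIMSEQ_Suc[OF l])
  then have "(\<lambda>k. nrm (a k)) \<longlonglongrightarrow> 0"
    by (simp add: tendsto_iff_nrm)
  then have "\<forall>\<^sub>F k in sequentially. nrm (a k) < r"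
    using assms(2) by (rule order_tendstoD(2))
  then show ?thesis
    unfolding eventually_sequentially by (meson less_imp_le)
qed

text \<open>
  All partial sums differ from the first term by something of absolute value below \<open>1\<close>, and the sum
  differs from some partial sum by less than \<open>1\<close>.
\<close>

lemma nrm_sums_eq_one:
  assumes "a sums s" "nrm (a 0) = 1" "\<And>i. i > 0 \<Longrightarrow> nrm (a i) < 1"
  shows "nrm s = 1"
proof -
  have "(\<lambda>k. \<Sum>i<Suc k. a i) \<longlonglongrightarrow> s"
    using assms(1) unfolding sums_def by (rule LIMSEQ_Suc)
  then have "\<forall>\<^sub>F k in sequentially. nrm ((\<Sum>i<Suc k. a i) - s) < 1"
    unfolding tendsto_iff_nrm by (rule order_tendstoD(2)) simp
  then obtain k where k: "nrm ((\<Sum>i<Suc k. a i) - s) < 1"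
    using eventually_happens trivial_limit_sequentially by blast
  obtain \<rho> where \<rho>: "0 < \<rho>" "\<rho> < 1" "\<And>i. i < k \<Longrightarrow> nrm (a (Suc i)) \<le> \<rho>"
    using finite_nrm_less_one[of "{..<k}" "\<lambda>i. nrm (a (Suc i))"] assms(3) by auto
  have "(\<Sum>i<Suc k. a i) - a 0 = (\<Sum>i<k. a (Suc i))"
    unfolding sum.lessThan_Suc_shift by simp
  then have "nrm ((\<Sum>i<Suc k. a i) - a 0) \<le> \<rho>"
    using \<rho> by (auto intro!: nrm_sum_le)
  then have "nrm (\<Sum>i<Suc k. a i) = 1"
    using nrm_eq_of_close[of "\<Sum>i<Suc k. a i" "a 0"] assms(2) \<rho> by simp
  then show ?thesis
    using nrm_eq_of_close[of s "\<Sum>i<Suc k. a i"] k nrm_minus_commute[of s] by simp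
qed

text \<open>
  Since one factor is a polynomial, induction on it replaces the theory of Cauchy products: the
  step for \<open>a + X P\<close> only shifts the partial sums by one.
\<close>

lemma sums_poly_mult:
  fixes f :: "'c fps"
  assumes "(\<lambda>i. fps_nth f i * x ^ i) sums s"
  shows "(\<lambda>i. fps_nth (fps_of_poly P * f) i * x ^ i) sums (poly P x * s)"
proof (induction P)
  case 0
  then show ?case by simp
next
  case (pCons a P)
  let ?S = "\<lambda>g k. \<Sum>i<k. fps_nth g i * x ^ i"
  have "?S (fps_of_poly (pCons a P) * f) (Suc k) = a * ?S f (Suc k) - (- x) * ?S (fps_of_poly P * f) k" for k
  proof -
    have *: "fps_nth (fps_of_poly (pCons a P) * f) i
        = a * fps_nth f i + (if i = 0 then 0 else fps_nth (fps_of_poly P * f) (i - 1))" for i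
      by (simp add: fps_of_poly_pCons ring_distribs mult.assoc[of fps_X] mult.commute[of _ fps_X])
    show ?thesis
      unfolding * ring_distribs sum.distrib
      by (simp add: sum.lessThan_Suc_shift sum_distrib_left sum_negf algebra_simps del: sum.lessThan_Suc)
  qed
  moreover have "(\<lambda>k. a * ?S f (Suc k) - (- x) * ?S (fps_of_poly P * f) k) \<longlonglongrightarrow> a * s - (- x) * (poly P x * s)"
    by (rule tendsto_diff_nrm[OF tendsto_mult_nrm[OF tendsto_const LIMSEQ_Suc[OF assms[unfolded sums_def]]]
          tendsto_mult_nrm[OF tendsto_const pCons.IH[unfolded sums_def]]])
  ultimately have "(\<lambda>k. ?S (fps_of_poly (pCons a P) * f) (Suc k)) \<longlonglongrightarrow> a * s - (- x) * (poly P x * s)"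
    by simp
  then have "?S (fps_of_poly (pCons a P) * f) \<longlonglongrightarrow> a * s - (- x) * (poly P x * s)"
    by (simp only: filterlim_sequentially_Suc[of "?S (fps_of_poly (pCons a P) * f)"])
  moreover have "a * s - (- x) * (poly P x * s) = poly (pCons a P) x * s"
    by (simp add: algebra_simps)
  ultimately show ?case
    unfolding sums_def by (simp only:)
qed

text \<open>
  Under the hypotheses \<open>|h(x)| = 1\<close>, so the value of \<open>c P h\<close> at \<open>x\<close> is that of \<open>P\<close> up to a factor of
  absolute value \<open>1\<close>. Phrasing the hypotheses on the terms \<open>h\<^sub>i x\<^sup>i\<close> covers the open and the closed
  disc at once.
\<close>

lemma v_value_eq_v_poly:
  assumes c: "nrm c = 1"
    and h: "\<And>r. r > 0 \<Longrightarrow> \<exists>M. \<forall>i\<ge>M. nrm (fps_nth h i * x ^ i) \<le> r"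
    and h0: "nrm (fps_nth h 0) = 1"
    and hi: "\<And>i. i > 0 \<Longrightarrow> nrm (fps_nth h i * x ^ i) < 1"
  shows "v (fps_value (fps_const c * fps_of_poly P * h) x) = v (poly P x)"
proof -
  obtain s where s: "(\<lambda>i. fps_nth h i * x ^ i) sums s"
    using summable_of_null[OF h] unfolding summable_def by blast
  have s1: "nrm s = 1"
    using nrm_sums_eq_one[OF s] h0 hi by simp
  have eq: "fps_const c * fps_of_poly P * h = fps_of_poly (Polynomial.smult c P) * h"
    by (simp add: fps_of_poly_smult)
  have "fps_value (fps_const c * fps_of_poly P * h) x = poly (Polynomial.smult c P) x * s"
    unfolding fps_value_def eq using sums_poly_mult[OF s] by (rule sums_unique[symmetric])
  then have "nrm (fps_value (fps_const c * fps_of_poly P * h) x) = nrm (poly P x)"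
    by (simp add: nrm_mult c s1)
  then show ?thesis
    using nrm_le_iff by (metis order_antisym order_refl)
qed

end

section \<open>The ring of integers of a finite extension\<close>

locale padic_finite_extension = padic_complex_field p v
  for p :: nat and v :: "'c::{field_char_0, complete_space} \<Rightarrow> ereal" +
  fixes K :: "'c set"
  assumes finite_ext: "finite_extension_Qp K"
begin

abbreviation R :: "'c set" where
  "R \<equiv> integers_of v K"

lemma closed_K: "closed K"
proof -
  obtain B where B: "finite B" "B \<subseteq> K" "K \<subseteq> Qp_span B"
    using finite_ext unfolding finite_extension_Qp_def Qp_span_def by blast
  have K: "Qp \<subseteq> K" "\<And>x y. x \<in> K \<Longrightarrow> y \<in> K \<Longrightarrow> x - y \<in> K" "\<And>x y. x \<in> K \<Longrightarrow> y \<in> K \<Longrightarrow> x * y \<in> K"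
    using finite_ext unfolding finite_extension_Qp_def by blast+
  have K0: "0 \<in> K"
    using K(1) Qp_zero by blast
  have Kadd: "x + y \<in> K" if "x \<in> K" "y \<in> K" for x y
    using K(2)[OF that(1) K(2)[OF K0 that(2)]] by simp
  have "(\<Sum>b\<in>B'. c b * b) \<in> K" if "finite B'" "B' \<subseteq> B" "\<forall>b\<in>B. c b \<in> Qp" for B' and c :: "'c \<Rightarrow> 'c"
    using that(1,2)
  proof (induction B' rule: finite_induct)
    case (insert b B')
    then have "c b \<in> K" "b \<in> K" "(\<Sum>b\<in>B'. c b * b) \<in> K"
      using that(3) B(2) K(1) by blast+
    with insert.hyps show ?case
      by (simp add: Kadd K(3))
  qed (simp add: K0)
  then have "Qp_span B \<subseteq> K"
    using B(1) unfolding Qp_span_def by blast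
  with B(3) have "K = Qp_span B"
    by blast
  with closed_Qp_span[OF B(1)] show ?thesis
    by simp
qed

lemma R_iff: "x \<in> R \<longleftrightarrow> x \<in> K \<and> nrm x \<le> 1"
  by (simp add: integers_of_def nrm_le_1_iff)

lemma R_diff: "x \<in> R \<Longrightarrow> y \<in> R \<Longrightarrow> x - y \<in> R"
  using finite_ext unfolding R_iff finite_extension_Qp_def by (auto intro: nrm_diff_le)

lemma R_mult: "x \<in> R \<Longrightarrow> y \<in> R \<Longrightarrow> x * y \<in> R"
  using finite_ext nrm_mult_le[of x 1 y 1] unfolding R_iff finite_extension_Qp_def by auto

lemma R_one: "1 \<in> R" and R_zero: "0 \<in> R"
  using finite_ext Qp_zero Qp_one unfolding R_iff finite_extension_Qp_def by auto

lemma R_uminus: "x \<in> R \<Longrightarrow> - x \<in> R"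
  using R_diff[OF R_zero, of x] by simp

lemma R_add: "x \<in> R \<Longrightarrow> y \<in> R \<Longrightarrow> x + y \<in> R"
  using R_diff[of x "- y"] R_uminus[of y] by simp

lemma R_sum: "(\<And>i. i \<in> A \<Longrightarrow> f i \<in> R) \<Longrightarrow> (\<Sum>i\<in>A. f i) \<in> R"
  by (induction A rule: infinite_finite_induct) (auto intro: R_add R_zero)

lemma units_R_iff: "x \<in> units_in R \<longleftrightarrow> x \<in> K \<and> nrm x = 1"
proof
  assume "x \<in> units_in R"
  then obtain w where w: "x \<in> R" "w \<in> R" "x * w = 1"
    unfolding units_in_def by blast
  then have "nrm x \<le> 1" "nrm w \<le> 1" "nrm x * nrm w = 1" "x \<in> K"
    by (auto simp: R_iff nrm_mult[symmetric])
  moreover have "nrm x * nrm w \<le> nrm x"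
    using \<open>nrm w \<le> 1\<close> by (simp add: mult_left_le)
  ultimately show "x \<in> K \<and> nrm x = 1"
    by auto
next
  assume x: "x \<in> K \<and> nrm x = 1"
  then have "x \<noteq> 0" by auto
  moreover have "inverse x \<in> R"
    using x finite_ext unfolding R_iff finite_extension_Qp_def by (auto simp: nrm_inverse)
  ultimately show "x \<in> units_in R"
    using x unfolding units_in_def by (auto simp: R_iff intro!: bexI[of _ "inverse x"])
qed

lemma units_R_inverse: "x \<in> units_in R \<Longrightarrow> inverse x \<in> units_in R"
  using finite_ext unfolding units_R_iff finite_extension_Qp_def by (auto simp: nrm_inverse)

lemma units_R_in_R: "x \<in> units_in R \<Longrightarrow> x \<in> R"
  by (simp add: units_R_iff R_iff)

section \<open>Power series with integral coefficients\<close>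

abbreviation RX :: "'c fps set" where
  "RX \<equiv> fps_over R"

lemma RX_iff: "f \<in> RX \<longleftrightarrow> (\<forall>i. fps_nth f i \<in> R)"
  by (simp add: fps_over_def)

lemma RX_D: "f \<in> RX \<Longrightarrow> fps_nth f i \<in> R"
  by (simp add: RX_iff)

lemma RX_gauss_le: "f \<in> RX \<Longrightarrow> gauss_le 1 f"
  by (simp add: RX_iff R_iff gauss_le_def)

lemma RX_add: "f \<in> RX \<Longrightarrow> g \<in> RX \<Longrightarrow> f + g \<in> RX"
  by (simp add: RX_iff R_add)

lemma RX_diff: "f \<in> RX \<Longrightarrow> g \<in> RX \<Longrightarrow> f - g \<in> RX"
  by (simp add: RX_iff R_diff)

lemma RX_mult: "f \<in> RX \<Longrightarrow> g \<in> RX \<Longrightarrow> f * g \<in> RX"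
  unfolding RX_iff fps_mult_nth by (auto intro!: R_sum R_mult)

lemma RX_one: "1 \<in> RX"
  by (simp add: RX_iff R_one R_zero)

lemma RX_const: "c \<in> R \<Longrightarrow> fps_const c \<in> RX"
  by (simp add: RX_iff R_zero)

text \<open>
  A power series with unit constant term is invertible over the same ring: the recursion for the
  coefficients of the inverse divides by the constant term only.
\<close>

lemma units_RX_I:
  assumes U: "U \<in> RX" and U0: "fps_nth U 0 \<in> units_in R"
  shows "U \<in> units_in RX"
proof -
  have nz: "fps_nth U 0 \<noteq> 0"
    using U0 by (auto simp: units_R_iff)
  define V where "V = inverse U"
  have UV: "U * V = 1"
    unfolding V_def using inverse_mult_eq_1'[OF nz] .
  have inv: "inverse (fps_nth U 0) \<in> R"
    by (intro units_R_in_R units_R_inverse U0)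
  have "fps_nth V k \<in> R" for k
  proof (induction k rule: less_induct)
    case (less k)
    show ?case
    proof (cases "k = 0")
      case True
      then show ?thesis
        using inv by (simp add: V_def)
    next
      case False
      have "fps_nth U 0 * fps_nth V k + (\<Sum>i=Suc 0..k. fps_nth U i * fps_nth V (k - i)) = fps_nth (U * V) k"
        unfolding fps_mult_nth by (subst sum.atLeast_Suc_atMost[of 0]) auto
      also have "\<dots> = 0"
        using False by (simp add: UV)
      finally have "fps_nth U 0 * fps_nth V k = - (\<Sum>i=Suc 0..k. fps_nth U i * fps_nth V (k - i))"
        by (simp add: eq_neg_iff_add_eq_0)
      then have "fps_nth V k = inverse (fps_nth U 0) * - (\<Sum>i=Suc 0..k. fps_nth U i * fps_nth V (k - i))"
        using nz by (simp add: field_simps)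
      moreover have "(\<Sum>i=Suc 0..k. fps_nth U i * fps_nth V (k - i)) \<in> R"
        using less.IH by (intro R_sum R_mult RX_D[OF U]) auto
      ultimately show ?thesis
        by (auto intro: R_mult R_uminus inv)
    qed
  qed
  then have "V \<in> RX"
    by (simp add: RX_iff)
  with U UV show ?thesis
    unfolding units_in_def by blast
qed

lemma units_RX_nth_0:
  assumes "U \<in> units_in RX"
  shows "fps_nth U 0 \<in> units_in R"
proof -
  obtain V where V: "U \<in> RX" "V \<in> RX" "U * V = 1"
    using assms unfolding units_in_def by blast
  then have "fps_nth U 0 * fps_nth V 0 = 1"
    by (metis fps_mult_nth_0 fps_one_nth)
  with V show ?thesis
    unfolding units_in_def by (auto simp: RX_D)
qed

text \<open>
  Completeness of the ring of power series over the integers of \<open>K\<close> under the Gauss norm, for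
  sequences with geometrically decreasing steps: each coefficient sequence is Cauchy, and its limit lies in
  the closed set \<open>K\<close>.
\<close>

lemma RX_limit:
  assumes s: "\<And>t. s t \<in> RX" and \<rho>: "0 < \<rho>" "\<rho> < 1"
    and step: "\<And>t. gauss_le (\<rho> ^ Suc t) (s (Suc t) - s t)"
  shows "\<exists>l\<in>RX. \<forall>t. gauss_le (\<rho> ^ Suc t) (l - s t)"
proof -
  have dec: "\<rho> ^ Suc u \<le> \<rho> ^ Suc t" if "t \<le> u" for t u
    using \<rho> that by (intro power_decreasing) auto
  have close: "nrm (fps_nth (s u) i - fps_nth (s t) i) \<le> \<rho> ^ Suc t" if "t \<le> u" for t u i
    using that
  proof (induction u rule: dec_induct)
    case base
    then show ?case using \<rho> by simp
  next
    case (step u)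
    have "nrm (fps_nth (s (Suc u)) i - fps_nth (s u) i) \<le> \<rho> ^ Suc t"
      using gauss_leD[OF assms(4)[of u], of i] dec[OF step.hyps(1)] by simp
    with step.IH have "nrm ((fps_nth (s (Suc u)) i - fps_nth (s u) i) + (fps_nth (s u) i - fps_nth (s t) i)) \<le> \<rho> ^ Suc t"
      by (intro nrm_add_le)
    then show ?case by simp
  qed
  have "\<exists>l\<in>R. \<forall>t. nrm (l - fps_nth (s t) i) \<le> \<rho> ^ Suc t" for i
  proof -
    let ?X = "\<lambda>t. fps_nth (s t) i"
    have "Cauchy ?X"
      unfolding Cauchy_nrm
    proof (intro allI impI)
      fix e :: real assume "e > 0"
      then obtain M where "\<rho> ^ M < e"
        using real_arch_pow_inv[OF _ \<rho>(2)] by blast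
      then have M: "\<rho> ^ Suc M < e"
        using \<rho> power_decreasing[of M "Suc M" \<rho>] by linarith
      have "nrm (?X j - ?X k) < e" if "j \<ge> M" "k \<ge> M" for j k
      proof -
        have "nrm ((?X j - ?X M) - (?X k - ?X M)) \<le> \<rho> ^ Suc M"
          by (intro nrm_diff_le close that)
        with M show ?thesis by simp
      qed
      then show "\<exists>M. \<forall>j\<ge>M. \<forall>k\<ge>M. nrm (?X j - ?X k) < e" by blast
    qed
    then obtain l where l: "?X \<longlonglongrightarrow> l"
      using Cauchy_convergent convergent_def by blast
    have lt: "nrm (l - ?X t) \<le> \<rho> ^ Suc t" for t
    proof -
      have "\<forall>\<^sub>F u in sequentially. nrm (?X u - l) < \<rho> ^ Suc t"
        using l \<rho> unfolding tendsto_iff_nrm by (intro order_tendstoD(2)) auto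
      then have "\<forall>\<^sub>F u in sequentially. nrm (?X u - l) < \<rho> ^ Suc t \<and> u \<ge> t"
        using eventually_ge_at_top[of t] by eventually_elim simp
      then obtain u where u: "nrm (?X u - l) < \<rho> ^ Suc t" "u \<ge> t"
        using eventually_happens trivial_limit_sequentially by blast
      have "nrm ((?X u - ?X t) - (?X u - l)) \<le> \<rho> ^ Suc t"
        by (rule nrm_diff_le[OF close[OF u(2)] less_imp_le[OF u(1)]])
      then show ?thesis by simp
    qed
    have "l \<in> K"
      using closed_sequentially[OF closed_K _ l] RX_D[OF s] by (simp add: R_iff)
    moreover have "nrm ((l - ?X 0) + ?X 0) \<le> 1"
      using lt[of 0] \<rho> RX_D[OF s, of 0 i] by (intro nrm_add_le) (auto simp: R_iff)
    ultimately show ?thesis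
      using lt by (intro bexI[of _ l]) (auto simp: R_iff)
  qed
  then obtain l where l: "\<And>i. l i \<in> R" "\<And>i t. nrm (l i - fps_nth (s t) i) \<le> \<rho> ^ Suc t"
    by metis
  then show ?thesis
    by (intro bexI[of _ "Abs_fps l"]) (auto simp: RX_iff gauss_le_def)
qed

lemma fps_eqI_gauss_le:
  assumes \<rho>: "0 < \<rho>" "\<rho> < 1" and "\<And>t. gauss_le (\<rho> ^ t) (f - g)"
  shows "f = g"
proof (rule fps_ext)
  fix i
  show "fps_nth f i = fps_nth g i"
  proof (rule ccontr)
    assume "fps_nth f i \<noteq> fps_nth g i"
    then have "nrm (fps_nth f i - fps_nth g i) > 0"
      using nrm_nonneg nrm_eq_0_iff by (simp add: order_less_le)
    then obtain t where "\<rho> ^ t < nrm (fps_nth f i - fps_nth g i)"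
      using real_arch_pow_inv[OF _ \<rho>(2)] by blast
    with gauss_leD[OF assms(3)[of t], of i] show False by simp
  qed
qed

section \<open>Factorization of series close to a polynomial\<close>

text \<open>
  A Hensel iteration that starts at \<open>Q \<cdot> 1\<close>. If \<open>f - P h\<close> has norm at most \<open>r\<close>, divide this error
  approximately by \<open>Q\<close>, with quotient \<open>a\<close> and remainder \<open>b\<close>, and pass to \<open>P + b\<close> and \<open>h + a\<close>. As
  \<open>P\<close> stays close to \<open>Q\<close> and \<open>h\<close> to \<open>1\<close>, the new error has norm at most \<open>\<rho> r\<close>. The ring \<open>Z\<close> is
  all of \<open>RX\<close> for the open disc and the ring of series with null coefficients for the closed disc. That
  division by \<open>Q\<close> is only asked for up to an error \<open>\<rho> r\<close> is what makes it available in the second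
  case, where it reduces to polynomials.
\<close>

lemma factorization_near_polynomial:
  assumes ZRX: "Z \<subseteq> RX" and Zadd: "\<And>f g. f \<in> Z \<Longrightarrow> g \<in> Z \<Longrightarrow> f + g \<in> Z"
    and Zdiff: "\<And>f g. f \<in> Z \<Longrightarrow> g \<in> Z \<Longrightarrow> f - g \<in> Z"
    and Zmult: "\<And>f g. f \<in> Z \<Longrightarrow> g \<in> Z \<Longrightarrow> f * g \<in> Z" and Z1: "1 \<in> Z"
    and Zlim: "\<And>l. l \<in> RX \<Longrightarrow> (\<And>r. r > 0 \<Longrightarrow> \<exists>g\<in>Z. gauss_le r (l - g)) \<Longrightarrow> l \<in> Z"
    and \<rho>: "0 < \<rho>" "\<rho> < 1"
    and division: "\<And>e r. e \<in> Z \<Longrightarrow> 0 < r \<Longrightarrow> gauss_le r e \<Longrightarrow>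
      \<exists>a\<in>Z. \<exists>b\<in>Z. (\<forall>i\<ge>N. fps_nth b i = 0) \<and> gauss_le r a \<and> gauss_le r b \<and> gauss_le (\<rho> * r) (e - Q * a - b)"
    and QZ: "Q \<in> Z" and fZ: "f \<in> Z" and fQ: "gauss_le \<rho> (f - Q)"
  shows "\<exists>P h. P \<in> Z \<and> h \<in> Z \<and> gauss_le \<rho> (P - Q) \<and> gauss_le \<rho> (h - 1) \<and>
    (\<forall>i\<ge>N. fps_nth P i = fps_nth Q i) \<and> f = P * h"
proof -
  define good where "good t = (\<lambda>(P, h). P \<in> Z \<and> h \<in> Z \<and> gauss_le \<rho> (P - Q) \<and> gauss_le \<rho> (h - 1) \<and>
    (\<forall>i\<ge>N. fps_nth P i = fps_nth Q i) \<and> gauss_le (\<rho> ^ Suc t) (f - P * h))" for t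
  define near where "near t = (\<lambda>(P, h) (P', h'). gauss_le (\<rho> ^ Suc t) (P' - P) \<and> gauss_le (\<rho> ^ Suc t) (h' - h))" for t
  have "\<exists>w. \<forall>t. good t (w t) \<and> near t (w t) (w (Suc t))"
  proof (rule dependent_nat_choice)
    have "gauss_le \<rho> 0" using \<rho> by (simp add: gauss_le_def)
    then show "\<exists>w. good 0 w"
      using QZ Z1 fQ by (intro exI[of _ "(Q, 1)"]) (simp add: good_def)
  next
    fix w t assume w: "good t w"
    obtain P h where Ph: "w = (P, h)" by (cases w)
    define r where "r = \<rho> ^ Suc t"
    have r: "0 < r" "r \<le> \<rho>"
      using \<rho> power_decreasing[of 1 "Suc t" \<rho>] by (auto simp: r_def)
    have P: "P \<in> Z" "h \<in> Z" "gauss_le \<rho> (P - Q)" "gauss_le \<rho> (h - 1)" "\<And>i. i \<ge> N \<Longrightarrow> fps_nth P i = fps_nth Q i"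
      and e: "gauss_le r (f - P * h)"
      using w by (auto simp: good_def Ph r_def)
    have "f - P * h \<in> Z"
      by (intro Zdiff Zmult fZ P)
    then obtain a b where ab: "a \<in> Z" "b \<in> Z" "\<And>i. i \<ge> N \<Longrightarrow> fps_nth b i = 0"
      "gauss_le r a" "gauss_le r b" "gauss_le (\<rho> * r) (f - P * h - Q * a - b)"
      using division[OF _ r(1) e] by blast
    \<comment> \<open>The first term is the division error; each of the others has a factor of norm at most \<open>r\<close> and one of norm at most \<open>\<rho>\<close>.\<close>
    have "f - (P + b) * (h + a) = (f - P * h - Q * a - b) - (P - Q) * a - b * (h - 1) - b * a"
      by (simp add: algebra_simps)
    moreover have "gauss_le (\<rho> * r) (b * (h - 1))" "gauss_le (\<rho> * r) (b * a)"
      using gauss_le_mult[OF ab(5) P(4)] gauss_le_mono[OF gauss_le_mult[OF ab(5) ab(4)], of "\<rho> * r"] r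
      by (simp_all add: mult.commute)
    then have "gauss_le (\<rho> * r) ((f - P * h - Q * a - b) - (P - Q) * a - b * (h - 1) - b * a)"
      using gauss_le_diff[OF gauss_le_diff[OF gauss_le_diff[OF ab(6) gauss_le_mult[OF P(3) ab(4)]]]] by blast
    ultimately have "gauss_le (\<rho> * r) (f - (P + b) * (h + a))"
      by (simp only:)
    then have "gauss_le (\<rho> ^ Suc (Suc t)) (f - (P + b) * (h + a))"
      by (simp add: r_def)
    moreover have "gauss_le \<rho> ((P - Q) + b)" "gauss_le \<rho> ((h - 1) + a)"
      by (intro gauss_le_add P gauss_le_mono[OF ab(4) r(2)] gauss_le_mono[OF ab(5) r(2)])+
    moreover have "(P - Q) + b = (P + b) - Q" "(h - 1) + a = (h + a) - 1"
      by auto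
    ultimately have "good (Suc t) (P + b, h + a)"
      using P ab by (auto simp: good_def intro: Zadd)
    moreover have "near t w (P + b, h + a)"
      using ab by (simp add: near_def Ph r_def)
    ultimately show "\<exists>w'. good (Suc t) w' \<and> near t w w'"
      by blast
  qed
  then obtain w where w: "\<And>t. good t (w t)" "\<And>t. near t (w t) (w (Suc t))"
    by blast
  define P h where "P t = fst (w t)" and "h t = snd (w t)" for t
  have good: "P t \<in> Z" "h t \<in> Z" "gauss_le \<rho> (P t - Q)" "gauss_le \<rho> (h t - 1)"
    "\<And>i. i \<ge> N \<Longrightarrow> fps_nth (P t) i = fps_nth Q i" "gauss_le (\<rho> ^ Suc t) (f - P t * h t)" for t
    using w(1)[of t] by (auto simp: good_def P_def h_def split: prod.splits)
  have near: "gauss_le (\<rho> ^ Suc t) (P (Suc t) - P t)" "gauss_le (\<rho> ^ Suc t) (h (Suc t) - h t)" for t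
    using w(2)[of t] by (auto simp: near_def P_def h_def split: prod.splits)
  obtain P' where P': "P' \<in> RX" "\<And>t. gauss_le (\<rho> ^ Suc t) (P' - P t)"
    using RX_limit[of P \<rho>] near good(1) ZRX \<rho> by blast
  obtain h' where h': "h' \<in> RX" "\<And>t. gauss_le (\<rho> ^ Suc t) (h' - h t)"
    using RX_limit[of h \<rho>] near good(2) ZRX \<rho> by blast
  have small: "\<exists>t. \<rho> ^ Suc t \<le> r" if pos: "r > 0" for r
  proof -
    obtain t where "\<rho> ^ t < r"
      using real_arch_pow_inv[OF pos \<rho>(2)] by blast
    then have "\<rho> ^ Suc t \<le> r"
      using \<rho> power_decreasing[of t "Suc t" \<rho>] by linarith
    then show ?thesis ..
  qed
  have "P' \<in> Z"
  proof (rule Zlim[OF P'(1)])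
    fix r :: real assume "r > 0"
    with small P'(2) good(1) show "\<exists>g\<in>Z. gauss_le r (P' - g)"
      by (meson gauss_le_mono)
  qed
  moreover have "h' \<in> Z"
  proof (rule Zlim[OF h'(1)])
    fix r :: real assume "r > 0"
    with small h'(2) good(2) show "\<exists>g\<in>Z. gauss_le r (h' - g)"
      by (meson gauss_le_mono)
  qed
  moreover have "gauss_le \<rho> (P' - Q)" "gauss_le \<rho> (h' - 1)"
    using P'(2)[of 0] h'(2)[of 0] gauss_le_add[OF _ good(3)[of 0], of "P' - P 0"]
      gauss_le_add[OF _ good(4)[of 0], of "h' - h 0"] by simp_all
  moreover have "fps_nth P' i = fps_nth Q i" if "i \<ge> N" for i
  proof -
    have "nrm (fps_nth P' i - fps_nth Q i) \<le> 0"
    proof (rule field_le_epsilon)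
      fix r :: real assume "r > 0"
      then obtain t where "\<rho> ^ Suc t \<le> r" using small by blast
      with gauss_leD[OF P'(2)[of t], of i] good(5)[OF that] show "nrm (fps_nth P' i - fps_nth Q i) \<le> 0 + r"
        by simp
    qed
    then show ?thesis
      using nrm_nonneg nrm_eq_0_iff by (metis order_antisym right_minus_eq)
  qed
  moreover have "f = P' * h'"
  proof (rule fps_eqI_gauss_le[OF \<rho>])
    fix t
    have "f - P' * h' = (f - P t * h t) - (P' - P t) * h' - P t * (h' - h t)"
      by (simp add: algebra_simps)
    moreover have "gauss_le (\<rho> ^ Suc t) ((P' - P t) * h')" "gauss_le (\<rho> ^ Suc t) (P t * (h' - h t))"
      using gauss_le_mult[OF P'(2)[of t] RX_gauss_le[OF h'(1)]] gauss_le_mult[OF RX_gauss_le h'(2)[of t], of "P t"] good(1) ZRX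
      by auto
    then have "gauss_le (\<rho> ^ Suc t) ((f - P t * h t) - (P' - P t) * h' - P t * (h' - h t))"
      using gauss_le_diff[OF gauss_le_diff[OF good(6)]] by blast
    ultimately have "gauss_le (\<rho> ^ Suc t) (f - P' * h')"
      by (simp only:)
    have "\<rho> ^ Suc t \<le> \<rho> ^ t"
      using \<rho> by (intro power_decreasing) auto
    then show "gauss_le (\<rho> ^ t) (f - P' * h')"
      using gauss_le_mono[OF \<open>gauss_le (\<rho> ^ Suc t) (f - P' * h')\<close>] by blast
  qed
  ultimately show ?thesis
    by (intro exI[of _ P'] exI[of _ h']) auto
qed

lemma fps_of_poly_of_bounded_support:
  fixes P :: "'c fps"
  assumes "\<And>i. i > N \<Longrightarrow> fps_nth P i = 0" "fps_nth P N \<noteq> 0"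
  shows "\<exists>q. fps_of_poly q = P \<and> degree q = N"
proof -
  define q where "q = (\<Sum>i\<le>N. Polynomial.monom (fps_nth P i) i)"
  have c: "coeff q i = fps_nth P i" for i
    using assms(1)[of i] by (simp add: q_def coeff_sum)
  then have "fps_of_poly q = P"
    by (simp add: fps_eq_iff)
  moreover have "degree q = N"
    using assms by (intro antisym degree_le le_degree) (auto simp: c)
  ultimately show ?thesis by blast
qed

section \<open>The Tate algebra\<close>

text \<open>
  The integral Tate algebra: its elements are the integral series that converge on the closed disc (\<open>fps_c_iff_tate\<close>).
\<close>

definition tate :: "'c fps set" where
  "tate = {f \<in> RX. \<forall>r>0. \<exists>M. \<forall>i\<ge>M. nrm (fps_nth f i) \<le> r}"

lemma tate_RX: "f \<in> tate \<Longrightarrow> f \<in> RX"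
  by (simp add: tate_def)

lemma tateD: "f \<in> tate \<Longrightarrow> r > 0 \<Longrightarrow> \<exists>M. \<forall>i\<ge>M. nrm (fps_nth f i) \<le> r"
  by (simp add: tate_def)

lemma tate_add:
  assumes "f \<in> tate" "g \<in> tate" shows "f + g \<in> tate"
  unfolding tate_def
proof (intro CollectI conjI allI impI)
  fix r :: real assume "r > 0"
  with assms obtain M M' where "\<And>i. i \<ge> M \<Longrightarrow> nrm (fps_nth f i) \<le> r" "\<And>i. i \<ge> M' \<Longrightarrow> nrm (fps_nth g i) \<le> r"
    using tateD by metis
  then show "\<exists>M. \<forall>i\<ge>M. nrm (fps_nth (f + g) i) \<le> r"
    by (intro exI[of _ "max M M'"]) (auto intro: nrm_add_le)
qed (use assms tate_RX RX_add in blast)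

lemma tate_mult:
  assumes "f \<in> tate" "g \<in> tate" shows "f * g \<in> tate"
  unfolding tate_def
proof (intro CollectI conjI allI impI)
  fix r :: real assume r: "r > 0"
  with assms obtain M M' where M: "\<And>i. i \<ge> M \<Longrightarrow> nrm (fps_nth f i) \<le> r" "\<And>i. i \<ge> M' \<Longrightarrow> nrm (fps_nth g i) \<le> r"
    using tateD by metis
  have b: "nrm (fps_nth f i) \<le> 1" "nrm (fps_nth g i) \<le> 1" for i
    using assms tate_RX RX_gauss_le gauss_leD by blast+
  have "nrm (fps_nth f i * fps_nth g (k - i)) \<le> r" if "k \<ge> M + M'" for k i
  proof (cases "i \<ge> M")
    case True
    then show ?thesis
      using nrm_mult_le[OF M(1)[OF True] b(2)[of "k - i"]] r by simp
  next
    case False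
    with that have "k - i \<ge> M'" by simp
    then show ?thesis
      using nrm_mult_le[OF b(1)[of i] M(2)[of "k - i"]] by simp
  qed
  then show "\<exists>M. \<forall>i\<ge>M. nrm (fps_nth (f * g) i) \<le> r"
    unfolding fps_mult_nth using r by (intro exI[of _ "M + M'"]) (auto intro!: nrm_sum_le)
qed (use assms tate_RX RX_mult in blast)

lemma tate_finite_support:
  assumes "f \<in> RX" "\<And>i. i \<ge> M \<Longrightarrow> fps_nth f i = 0"
  shows "f \<in> tate"
  using assms unfolding tate_def by (auto intro!: exI[of _ M])

lemma tate_one: "1 \<in> tate"
  by (rule tate_finite_support[OF RX_one, of 1]) auto

lemma tate_const: "c \<in> R \<Longrightarrow> fps_const c \<in> tate"
  by (rule tate_finite_support[OF RX_const, of _ 1]) auto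

lemma tate_diff: 
  assumes "f \<in> tate" "g \<in> tate" shows "f - g \<in> tate"
  using tate_add[OF assms(1) tate_mult[OF tate_const[OF R_uminus[OF R_one]] assms(2)]]
  by (simp add: fps_const_neg[symmetric] del: fps_const_neg)

lemma tate_limit:
  assumes l: "l \<in> RX" and g: "\<And>r. r > 0 \<Longrightarrow> \<exists>g\<in>tate. gauss_le r (l - g)"
  shows "l \<in> tate"
  unfolding tate_def
proof (intro CollectI conjI allI impI l)
  fix r :: real assume r: "r > 0"
  then obtain g where g: "g \<in> tate" "gauss_le r (l - g)" using g by blast
  then obtain M where M: "\<And>i. i \<ge> M \<Longrightarrow> nrm (fps_nth g i) \<le> r" using tateD r by blast
  have "nrm ((fps_nth l i - fps_nth g i) + fps_nth g i) \<le> r" if "i \<ge> M" for i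
    using gauss_leD[OF g(2), of i] M[OF that] by (intro nrm_add_le) auto
  then show "\<exists>M. \<forall>i\<ge>M. nrm (fps_nth l i) \<le> r" by auto
qed

text \<open>
  Convergence at the single point \<open>1\<close> already forces the coefficients to tend to zero.
\<close>

lemma fps_c_iff_tate: "f \<in> fps_c v K \<longleftrightarrow> f \<in> tate"
proof
  assume f: "f \<in> fps_c v K"
  have "1 \<in> integers_of v UNIV"
    by (simp add: integers_of_def)
  with f have "summable (\<lambda>i. fps_nth f i * 1 ^ i)" "f \<in> RX"
    unfolding fps_c_def fps_over_conv_def by blast+
  then show "f \<in> tate"
    using null_of_summable[of "fps_nth f"] by (simp add: tate_def)
next
  assume f: "f \<in> tate"
  have "summable (\<lambda>i. fps_nth f i * x ^ i)" if "x \<in> integers_of v UNIV" for x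
  proof (rule summable_of_null)
    fix r :: real assume "r > 0"
    then obtain M where M: "\<And>i. i \<ge> M \<Longrightarrow> nrm (fps_nth f i) \<le> r" using tateD f by blast
    have "nrm x ^ i \<le> 1" for i
      using that by (auto simp: integers_of_def nrm_le_1_iff intro: power_le_one)
    then have "nrm (fps_nth f i * x ^ i) \<le> r * 1" if "i \<ge> M" for i
      using M[OF that] \<open>r > 0\<close> by (intro nrm_mult_le) (auto simp: nrm_power)
    then show "\<exists>M. \<forall>i\<ge>M. nrm (fps_nth f i * x ^ i) \<le> r" by auto
  qed
  then show "f \<in> fps_c v K"
    using tate_RX[OF f] unfolding fps_c_def fps_over_conv_def by blast
qed

text \<open>
  The recursion \<open>h\<^sub>0 V\<^sub>k = - \<Sum>\<^sub>i\<^sub>>\<^sub>0 h\<^sub>i V\<^sub>k\<^sub>-\<^sub>i\<close> improves the eventual bound \<open>\<rho>\<^sup>t\<close> on \<open>V\<close> to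
  \<open>\<rho>\<^sup>t\<^sup>+\<^sup>1\<close>: each term has a factor \<open>h\<^sub>i\<close> of large index, which is small, or a factor \<open>V\<^sub>k\<^sub>-\<^sub>i\<close> of large
  index, to which the previous bound applies.
\<close>

lemma tate_inverse:
  assumes h: "h \<in> tate" and V: "V \<in> RX" "h * V = 1"
    and h0: "nrm (fps_nth h 0) = 1" and hi: "\<And>i. i > 0 \<Longrightarrow> nrm (fps_nth h i) < 1"
  shows "V \<in> tate"
proof -
  obtain M where M: "\<And>i. i \<ge> M \<Longrightarrow> nrm (fps_nth h i) \<le> 1/2"
    using tateD[OF h, of "1/2"] by auto
  obtain \<rho>' where \<rho>': "0 < \<rho>'" "\<rho>' < 1" "\<And>i. i \<in> {0<..<M} \<Longrightarrow> nrm (fps_nth h i) \<le> \<rho>'"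
    using finite_nrm_less_one[of "{0<..<M}" "\<lambda>i. nrm (fps_nth h i)"] hi by auto
  define \<rho> where "\<rho> = max \<rho>' (1/2)"
  have \<rho>: "0 < \<rho>" "\<rho> < 1" using \<rho>' by (auto simp: \<rho>_def)
  have h\<rho>: "nrm (fps_nth h i) \<le> \<rho>" if "i > 0" for i
    using M[of i] \<rho>'(3)[of i] that by (cases "i < M") (force simp: \<rho>_def)+
  have b: "nrm (fps_nth V i) \<le> 1" for i
    using V RX_gauss_le gauss_leD by blast
  have rec: "nrm (fps_nth V k) \<le> r" if "k > 0" "0 \<le> r"
    "\<And>i. 0 < i \<Longrightarrow> i \<le> k \<Longrightarrow> nrm (fps_nth h i * fps_nth V (k - i)) \<le> r" for k r
  proof -
    have "fps_nth h 0 * fps_nth V k + (\<Sum>i=Suc 0..k. fps_nth h i * fps_nth V (k - i)) = fps_nth (h * V) k"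
      unfolding fps_mult_nth by (subst sum.atLeast_Suc_atMost[of 0]) auto
    also have "\<dots> = 0"
      using that(1) by (simp add: V)
    finally have "fps_nth h 0 * fps_nth V k = - (\<Sum>i=Suc 0..k. fps_nth h i * fps_nth V (k - i))"
      by (simp add: eq_neg_iff_add_eq_0)
    then have "nrm (fps_nth h 0 * fps_nth V k) = nrm (\<Sum>i=Suc 0..k. fps_nth h i * fps_nth V (k - i))"
      by simp
    also have "\<dots> \<le> r"
      using that by (intro nrm_sum_le) auto
    finally show ?thesis
      by (simp add: nrm_mult h0)
  qed
  have decay: "\<exists>T. \<forall>k\<ge>T. nrm (fps_nth V k) \<le> \<rho> ^ t" for t
  proof (induction t)
    case 0
    then show ?case using b by simp
  next
    case (Suc t)
    then obtain T where T: "\<And>k. k \<ge> T \<Longrightarrow> nrm (fps_nth V k) \<le> \<rho> ^ t" by blast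
    obtain T' where T': "\<And>i. i \<ge> T' \<Longrightarrow> nrm (fps_nth h i) \<le> \<rho> ^ Suc t"
      using tateD[OF h, of "\<rho> ^ Suc t"] \<rho> by auto
    have "nrm (fps_nth V k) \<le> \<rho> ^ Suc t" if k: "k \<ge> Suc (T + T')" for k
    proof (rule rec)
      fix i assume i: "0 < i" "i \<le> k"
      show "nrm (fps_nth h i * fps_nth V (k - i)) \<le> \<rho> ^ Suc t"
      proof (cases "i \<ge> T'")
        case True
        then show ?thesis
          using nrm_mult_le[OF T'[OF True] b[of "k - i"]] \<rho> by simp
      next
        case False
        with k have "k - i \<ge> T" by simp
        then show ?thesis
          using nrm_mult_le[OF h\<rho>[OF i(1)] T[of "k - i"]] \<rho> by simp
      qed
    qed (use k \<rho> in auto)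
    then show ?case by blast
  qed
  show ?thesis
    unfolding tate_def
  proof (intro CollectI conjI allI impI V)
    fix r :: real assume "r > 0"
    then obtain t where "\<rho> ^ t < r"
      using real_arch_pow_inv[OF _ \<rho>(2)] by blast
    moreover obtain T where "\<forall>k\<ge>T. nrm (fps_nth V k) \<le> \<rho> ^ t" using decay by blast
    ultimately show "\<exists>M. \<forall>i\<ge>M. nrm (fps_nth V i) \<le> r"
      by (meson less_imp_le order_trans)
  qed
qed

section \<open>Division by monic polynomials\<close>

text \<open>
  Where \<open>q d\<close> vanishes, the leading \<open>1\<close> of \<open>q\<close> lets one solve for \<open>d\<^sub>k\<close> in terms of the next \<open>N\<close>
  coefficients \<open>d\<^sub>k\<^sub>+\<^sub>1, \<dots>, d\<^sub>k\<^sub>+\<^sub>N\<close>.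
\<close>

lemma nrm_backward:
  assumes q: "fps_nth q N = 1" "\<And>i. i > N \<Longrightarrow> fps_nth q i = 0"
    and qd: "fps_nth (q * d) (k + N) = 0"
    and r: "0 \<le> r" "\<And>i. i < N \<Longrightarrow> nrm (fps_nth q i * fps_nth d (k + N - i)) \<le> r"
  shows "nrm (fps_nth d k) \<le> r"
proof -
  have "fps_nth (q * d) (k + N) = (\<Sum>i\<in>{0..N}. fps_nth q i * fps_nth d (k + N - i))"
    unfolding fps_mult_nth using q(2) by (intro sum.mono_neutral_right) auto
  also have "{0..N} = insert N {..<N}" by auto
  finally have "fps_nth d k = - (\<Sum>i<N. fps_nth q i * fps_nth d (k + N - i))"
    using qd q(1) by (simp add: eq_neg_iff_add_eq_0)
  then have "nrm (fps_nth d k) = nrm (\<Sum>i<N. fps_nth q i * fps_nth d (k + N - i))"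
    by simp
  also have "\<dots> \<le> r"
    using r by (intro nrm_sum_le) auto
  finally show ?thesis .
qed

text \<open>
  Each use of the backward recursion multiplies a bound on all of \<open>d\<close> by \<open>\<rho> < 1\<close>.
\<close>

lemma distinguished_quotient_zero:
  assumes q: "fps_nth q N = 1" "\<And>i. i > N \<Longrightarrow> fps_nth q i = 0" "\<And>i. i < N \<Longrightarrow> nrm (fps_nth q i) < 1"
    and d: "d \<in> RX" and qd: "\<And>i. i \<ge> N \<Longrightarrow> fps_nth (q * d) i = 0"
  shows "d = 0"
proof -
  obtain \<rho> where \<rho>: "0 < \<rho>" "\<rho> < 1" "\<And>i. i < N \<Longrightarrow> nrm (fps_nth q i) \<le> \<rho>"
    using finite_nrm_less_one[of "{..<N}" "\<lambda>i. nrm (fps_nth q i)"] q(3) by auto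
  have "gauss_le (\<rho> ^ t) d" for t
  proof (induction t)
    case 0
    then show ?case using RX_gauss_le[OF d] by simp
  next
    case (Suc t)
    show ?case
      unfolding gauss_le_def
    proof
      fix k
      show "nrm (fps_nth d k) \<le> \<rho> ^ Suc t"
      proof (rule nrm_backward[OF q(1,2)])
        fix i assume "i < N"
        then show "nrm (fps_nth q i * fps_nth d (k + N - i)) \<le> \<rho> ^ Suc t"
          using nrm_mult_le[OF \<rho>(3) gauss_leD[OF Suc.IH]] \<rho>(1) by simp
      qed (use \<rho> qd in auto)
    qed
  qed
  then show ?thesis
    by (intro fps_eqI_gauss_le[OF \<rho>(1,2)]) simp
qed

text \<open>
  The backward recursion does not increase bounds, so a bound that holds from some index on, which the
  null coefficients of \<open>d\<close> provide for every radius, spreads down to all indices.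
\<close>

lemma monic_quotient_zero:
  assumes q: "q \<in> RX" "fps_nth q N = 1" "\<And>i. i > N \<Longrightarrow> fps_nth q i = 0"
    and d: "d \<in> tate" and qd: "\<And>i. i \<ge> N \<Longrightarrow> fps_nth (q * d) i = 0"
  shows "d = 0"
proof -
  have small: "nrm (fps_nth d k) \<le> r" if r: "r > 0" for k r
  proof -
    obtain M where M: "\<And>i. i \<ge> M \<Longrightarrow> nrm (fps_nth d i) \<le> r"
      using tateD[OF d r] by blast
    show ?thesis
    proof (induction "M - k" arbitrary: k rule: less_induct)
      case less
      show ?case
      proof (cases "k \<ge> M")
        case False
        show ?thesis
        proof (rule nrm_backward[OF q(2,3)])
          fix i assume "i < N"
          with False have "nrm (fps_nth d (k + N - i)) \<le> r"
            by (intro less) auto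
          then show "nrm (fps_nth q i * fps_nth d (k + N - i)) \<le> r"
            using nrm_mult_le[OF gauss_leD[OF RX_gauss_le[OF q(1)]]] by simp
        qed (use r qd in auto)
      qed (use M in simp)
    qed
  qed
  have "nrm (fps_nth d k) \<le> 0" for k
  proof (rule field_le_epsilon)
    fix r :: real assume "r > 0"
    with small[OF this, of k] show "nrm (fps_nth d k) \<le> 0 + r" by simp
  qed
  then have "nrm (fps_nth d k) = 0" for k
    by (intro antisym) simp_all
  then show ?thesis
    by (intro fps_ext) simp
qed

text \<open>
  Long division by a monic polynomial, cancelling the top coefficient of \<open>e\<close>; subtracting integral
  multiples of \<open>Q\<close> never leaves the ball of radius \<open>r\<close>. Polynomials are represented as series with
  finitely many coefficients, as the Hensel iteration uses them.
\<close>

lemma finite_division: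
  assumes Q: "Q \<in> RX" "fps_nth Q N = 1" "\<And>i. i > N \<Longrightarrow> fps_nth Q i = 0"
    and e: "e \<in> RX" "gauss_le r e" "\<And>i. i \<ge> T \<Longrightarrow> fps_nth e i = 0"
  shows "\<exists>a\<in>tate. \<exists>b\<in>tate. (\<forall>i\<ge>N. fps_nth b i = 0) \<and> gauss_le r a \<and> gauss_le r b \<and> e = Q * a + b"
  using e
proof (induction T arbitrary: e)
  case 0
  then have "e = 0" by (intro fps_ext) simp
  moreover have "0 \<in> tate"
    by (rule tate_finite_support[of _ 0]) (auto simp: RX_iff R_zero)
  ultimately show ?case
    using 0 by (intro bexI[of _ 0]) auto
next
  case (Suc T)
  have r: "0 \<le> r" using gauss_le_nonneg Suc.prems(2) .
  show ?case
  proof (cases "T < N")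
    case True
    have "0 \<in> tate"
      by (rule tate_finite_support[of _ 0]) (auto simp: RX_iff R_zero)
    moreover have "e \<in> tate" 
      using Suc.prems by (intro tate_finite_support[of _ "Suc T"]) auto
    ultimately show ?thesis
      using Suc.prems True r by (intro bexI[of _ 0] bexI[of _ e]) (auto simp: gauss_le_def)
  next
    case False
    \<comment> \<open>The monomial whose product with \<open>Q\<close> has the same coefficient in degree \<open>T\<close> as \<open>e\<close>.\<close>
    define m where "m = Abs_fps (\<lambda>i. if i = T - N then fps_nth e T else 0)"
    have m: "m = fps_const (fps_nth e T) * fps_X ^ (T - N)"
      by (auto simp: m_def fps_eq_iff fps_X_power_nth)
    have mt: "m \<in> tate"
      using RX_D[OF Suc.prems(1)] by (intro tate_finite_support[of _ "Suc (T - N)"]) (auto simp: m_def RX_iff R_zero)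
    have mb: "gauss_le r m"
      using gauss_leD[OF Suc.prems(2)] r by (auto simp: m_def gauss_le_def)
    have Qm: "fps_nth (Q * m) i = (if i < T - N then 0 else fps_nth e T * fps_nth Q (i - (T - N)))" for i
      unfolding m by (simp add: fps_X_power_mult_right_nth mult.assoc[symmetric] mult.commute[of Q])
    have "\<exists>a\<in>tate. \<exists>b\<in>tate. (\<forall>i\<ge>N. fps_nth b i = 0) \<and> gauss_le r a \<and> gauss_le r b \<and> e - Q * m = Q * a + b"
    proof (rule Suc.IH)
      show "e - Q * m \<in> RX"
        by (intro RX_diff RX_mult Suc.prems Q tate_RX mt)
      show "gauss_le r (e - Q * m)"
        using gauss_le_mult[OF RX_gauss_le[OF Q(1)] mb] by (intro gauss_le_diff Suc.prems) simp
      show "fps_nth (e - Q * m) i = 0" if "i \<ge> T" for i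
      proof (cases "i = T")
        case True
        with False have "T - (T - N) = N" by simp
        with True show ?thesis using Q(2) by (simp add: Qm)
      next
        case False
        with that \<open>\<not> T < N\<close> have "i - (T - N) > N" "i \<ge> Suc T" by auto
        then show ?thesis using Q(3) Suc.prems(3) by (simp add: Qm)
      qed
    qed
    then obtain a b where ab: "a \<in> tate" "b \<in> tate" "\<forall>i\<ge>N. fps_nth b i = 0" "gauss_le r a" "gauss_le r b"
      "e - Q * m = Q * a + b" by blast
    have "e = Q * (a + m) + b"
      using ab(6) by (simp add: algebra_simps)
    with ab mt mb show ?thesis
      by (intro bexI[of _ "a + m"] bexI[of _ b]) (auto intro: gauss_le_add tate_add)
  qed
qed

section \<open>Weierstrass preparation\<close>

lemma max_ideal_iff: "x \<in> max_ideal_of v K \<longleftrightarrow> x \<in> K \<and> nrm x < 1"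
  by (simp add: max_ideal_of_def nrm_less_1_iff)

lemma near_one_unit:
  assumes h: "h \<in> RX" and b: "gauss_le \<rho> (h - 1)" and \<rho>: "\<rho> < 1"
  shows "h \<in> units_in RX" "nrm (fps_nth h 0) = 1" "i > 0 \<Longrightarrow> nrm (fps_nth h i) \<le> \<rho>"
proof -
  have "nrm (fps_nth h 0 - 1) < nrm 1"
    using gauss_leD[OF b, of 0] \<rho> by simp
  then show h0: "nrm (fps_nth h 0) = 1"
    using nrm_eq_of_close[of "fps_nth h 0" 1] by simp
  then show "h \<in> units_in RX"
    using h RX_D[OF h, of 0] by (intro units_RX_I) (auto simp: units_R_iff R_iff)
  show "nrm (fps_nth h i) \<le> \<rho>" if "i > 0"
    using gauss_leD[OF b, of i] that by simp
qed

text \<open>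
  Let \<open>B\<close> be the unit series \<open>F\<^sub>n + F\<^sub>n\<^sub>+\<^sub>1 X + \<dots>\<close> and \<open>A\<close> the part of \<open>F\<close> below degree \<open>n\<close>. Then
  \<open>F / B = X\<^sup>n + A / B\<close> is close to \<open>X\<^sup>n\<close>, and division by \<open>X\<^sup>n\<close> is exact: it is shift and cutoff.
\<close>

lemma weierstrass_o_exists:
  assumes F: "F \<in> RX" "fps_nth F n \<in> units_in R" "\<And>i. i < n \<Longrightarrow> nrm (fps_nth F i) < 1"
  shows "\<exists>P. degree P = n \<and> lead_coeff P = 1 \<and> (\<forall>i<degree P. coeff P i \<in> max_ideal_of v K) \<and>
    (\<exists>U \<in> units_in RX. F = fps_const (fps_nth F n) * fps_of_poly P * U)"
proof -
  obtain \<rho> where \<rho>: "0 < \<rho>" "\<rho> < 1" "\<And>i. i < n \<Longrightarrow> nrm (fps_nth F i) \<le> \<rho>"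
    using finite_nrm_less_one[of "{..<n}" "\<lambda>i. nrm (fps_nth F i)"] F(3) by auto
  define B where "B = fps_shift n F"
  have B: "B \<in> RX" "fps_nth B 0 = fps_nth F n"
    using F(1) by (auto simp: B_def RX_iff)
  then obtain C where C: "C \<in> RX" "B * C = 1"
    using units_RX_I[of B] F(2) unfolding units_in_def by auto
  define A where "A = fps_cutoff n F"
  have A: "gauss_le \<rho> A"
    using \<rho> by (auto simp: A_def gauss_le_def)
  have "F = fps_X ^ n * B + A"
    unfolding A_def B_def by (simp add: fps_shift_cutoff')
  then have FC: "F * C = fps_X ^ n + A * C"
    using C(2) by (simp add: ring_distribs mult.assoc)
  have XRX: "fps_X ^ n \<in> RX"
    by (simp add: RX_iff fps_X_power_nth R_one R_zero)
  have "\<exists>P h. P \<in> RX \<and> h \<in> RX \<and> gauss_le \<rho> (P - fps_X ^ n) \<and> gauss_le \<rho> (h - 1) \<and>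
      (\<forall>i\<ge>n. fps_nth P i = fps_nth (fps_X ^ n) i) \<and> F * C = P * h"
  proof (rule factorization_near_polynomial)
    fix e :: "'c fps" and r :: real assume e: "e \<in> RX" "0 < r" "gauss_le r e"
    have "e - fps_X ^ n * fps_shift n e - fps_cutoff n e = 0"
      using fps_shift_cutoff'[of n e] by (simp add: algebra_simps)
    then have "gauss_le (\<rho> * r) (e - fps_X ^ n * fps_shift n e - fps_cutoff n e)"
      using \<rho> e by (simp add: gauss_le_def)
    then show "\<exists>a\<in>RX. \<exists>b\<in>RX. (\<forall>i\<ge>n. fps_nth b i = 0) \<and> gauss_le r a \<and> gauss_le r b \<and> gauss_le (\<rho> * r) (e - fps_X ^ n * a - b)"
      using e by (intro bexI[of _ "fps_shift n e"] bexI[of _ "fps_cutoff n e"]) (auto simp: RX_iff gauss_le_def R_zero)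
  next
    show "gauss_le \<rho> (F * C - fps_X ^ n)"
      using gauss_le_mult[OF A RX_gauss_le[OF C(1)]] by (simp add: FC)
  qed (use \<rho> F C XRX RX_add RX_diff RX_mult RX_one in auto)
  then obtain P h where Ph: "P \<in> RX" "h \<in> RX" "gauss_le \<rho> (P - fps_X ^ n)" "gauss_le \<rho> (h - 1)"
    "\<And>i. i \<ge> n \<Longrightarrow> fps_nth P i = fps_nth (fps_X ^ n) i" "F * C = P * h"
    by blast
  obtain q where q: "fps_of_poly q = P" "degree q = n"
    using fps_of_poly_of_bounded_support[of n P] Ph(5) by (auto simp: fps_X_power_nth)
  have cq: "coeff q i = fps_nth P i" for i
    using q(1) by auto
  define c where "c = fps_nth F n"
  have c: "c \<noteq> 0" "inverse c \<in> R" "c \<in> units_in R"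
    using F(2) units_R_in_R[OF units_R_inverse[OF F(2)]] by (auto simp: c_def units_R_iff)
  define U where "U = fps_const (inverse c) * (h * B)"
  have "U \<in> RX"
    unfolding U_def by (intro RX_mult RX_const c Ph B)
  moreover have "fps_nth U 0 = fps_nth h 0"
    using c(1) B(2) by (simp add: U_def c_def)
  ultimately have U: "U \<in> units_in RX"
    using units_RX_nth_0[OF near_one_unit(1)[OF Ph(2,4) \<rho>(2)]] by (intro units_RX_I) auto
  have "F = (F * C) * B"
    using C(2) by (simp add: mult.assoc mult.commute[of C])
  also have "\<dots> = fps_of_poly q * (h * B)"
    by (simp add: Ph(6) q(1) mult.assoc)
  also have "h * B = fps_const c * U"
    using c(1) by (simp add: U_def mult.assoc[symmetric])
  finally have "F = fps_const c * fps_of_poly q * U"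
    by (simp add: mult_ac)
  moreover have "coeff q i \<in> max_ideal_of v K" if "i < n" for i
    using that gauss_leD[OF Ph(3), of i] \<rho>(2) RX_D[OF Ph(1), of i]
    by (simp add: max_ideal_iff cq fps_X_power_nth R_iff)
  ultimately show ?thesis
    using q(2) U Ph(5)[of n] by (intro exI[of _ q]) (auto simp: c_def cq fps_X_power_nth)
qed

text \<open>
  The quotient \<open>U' / U\<close> has integral coefficients because \<open>U\<close> is a unit; that it is \<open>1\<close> follows from
  \<open>P - P' = P' (U' / U - 1)\<close>, where the left side has degree below \<open>n\<close>.
\<close>

lemma weierstrass_o_unique:
  assumes c: "c \<noteq> 0"
    and P: "degree P = n" "lead_coeff P = 1" "\<forall>i<degree P. coeff P i \<in> max_ideal_of v K"
    and P': "degree P' = n" "lead_coeff P' = 1" "\<forall>i<degree P'. coeff P' i \<in> max_ideal_of v K"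
    and U: "U \<in> units_in RX" and U': "U' \<in> units_in RX"
    and eq: "fps_const c * fps_of_poly P * U = fps_const c * fps_of_poly P' * U'"
  shows "P = P'"
proof -
  obtain V where V: "V \<in> RX" "U * V = 1"
    using U unfolding units_in_def by blast
  have "fps_of_poly P * U = fps_of_poly P' * U'"
    using eq c by (simp add: mult.assoc)
  then have "fps_of_poly P * (U * V) = fps_of_poly P' * (U' * V)"
    by (metis mult.assoc)
  then have PV: "fps_of_poly P = fps_of_poly P' * (U' * V)"
    using V by simp
  have "U' * V - 1 = 0"
  proof (rule distinguished_quotient_zero[where q = "fps_of_poly P'" and N = n])
    show "U' * V - 1 \<in> RX"
      using U' V by (auto simp: units_in_def intro!: RX_diff RX_mult RX_one)
    fix i assume "i \<ge> n"
    have "fps_of_poly P' * (U' * V - 1) = fps_of_poly P - fps_of_poly P'"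
      by (simp add: PV algebra_simps)
    then show "fps_nth (fps_of_poly P' * (U' * V - 1)) i = 0"
      using \<open>i \<ge> n\<close> P P' by (cases "i = n") (auto simp: coeff_eq_0)
  qed (use P' in \<open>auto simp: coeff_eq_0 max_ideal_iff\<close>)
  then have "fps_of_poly P = fps_of_poly P'"
    using PV by simp
  then show ?thesis by simp
qed

text \<open>
  The tail of \<open>f = F / F\<^sub>N\<close> beyond degree \<open>N\<close> has norm below \<open>1\<close>, so \<open>f\<close> is close to its truncation
  \<open>Q\<close>, a monic polynomial. An element of the Tate algebra agrees with a polynomial up to any given
  error, so approximate division by \<open>Q\<close> is long division.
\<close>

lemma weierstrass_c_exists:
  assumes F: "F \<in> tate" "fps_nth F N \<in> units_in R" "\<And>i. i > N \<Longrightarrow> nrm (fps_nth F i) < 1"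
  shows "\<exists>P h. degree P = N \<and> lead_coeff P = 1 \<and> (\<forall>i. coeff P i \<in> R) \<and> h \<in> tate \<and> h \<in> units_in RX \<and>
    (\<forall>i>0. nrm (fps_nth h i) < 1) \<and> F = fps_const (fps_nth F N) * fps_of_poly P * h"
proof -
  define c where "c = fps_nth F N"
  have c: "c \<noteq> 0" "inverse c \<in> R" "nrm c = 1"
    using F(2) units_R_in_R[OF units_R_inverse[OF F(2)]] by (auto simp: c_def units_R_iff)
  define f where "f = fps_const (inverse c) * F"
  have f: "f \<in> tate" "fps_nth f N = 1" "\<And>i. nrm (fps_nth f i) = nrm (fps_nth F i)"
    using c F(1) by (auto simp: f_def nrm_mult nrm_inverse c_def intro: tate_mult tate_const)
  obtain M where M: "\<And>i. i \<ge> M \<Longrightarrow> nrm (fps_nth f i) \<le> 1/2"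
    using tateD[OF f(1), of "1/2"] by auto
  obtain \<rho>' where \<rho>': "0 < \<rho>'" "\<rho>' < 1" "\<And>i. i \<in> {N<..<M} \<Longrightarrow> nrm (fps_nth f i) \<le> \<rho>'"
    using finite_nrm_less_one[of "{N<..<M}" "\<lambda>i. nrm (fps_nth f i)"] F(3) f(3) by auto
  define \<rho> where "\<rho> = max \<rho>' (1/2)"
  have \<rho>: "0 < \<rho>" "\<rho> < 1" using \<rho>' by (auto simp: \<rho>_def)
  have f\<rho>: "nrm (fps_nth f i) \<le> \<rho>" if "i > N" for i
    using M[of i] \<rho>'(3)[of i] that by (cases "i < M") (force simp: \<rho>_def)+
  define Q where "Q = fps_cutoff (Suc N) f"
  have Q: "Q \<in> RX" "fps_nth Q N = 1" "\<And>i. i > N \<Longrightarrow> fps_nth Q i = 0"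
    using f tate_RX[OF f(1)] by (auto simp: Q_def RX_iff R_zero)
  have Qt: "Q \<in> tate"
    using Q by (intro tate_finite_support[of _ "Suc N"]) auto
  have "\<exists>P h. P \<in> tate \<and> h \<in> tate \<and> gauss_le \<rho> (P - Q) \<and> gauss_le \<rho> (h - 1) \<and>
      (\<forall>i\<ge>N. fps_nth P i = fps_nth Q i) \<and> f = P * h"
  proof (rule factorization_near_polynomial)
    fix e :: "'c fps" and r :: real assume e: "e \<in> tate" "0 < r" "gauss_le r e"
    then obtain T where T: "\<And>i. i \<ge> T \<Longrightarrow> nrm (fps_nth e i) \<le> \<rho> * r"
      using tateD[OF e(1), of "\<rho> * r"] \<rho> by auto
    have cut: "fps_cutoff T e \<in> RX" "gauss_le r (fps_cutoff T e)"
      using tate_RX[OF e(1)] e(2,3) by (auto simp: RX_iff gauss_le_def R_zero)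
    obtain a b where ab: "a \<in> tate" "b \<in> tate" "\<forall>i\<ge>N. fps_nth b i = 0" "gauss_le r a" "gauss_le r b"
      "fps_cutoff T e = Q * a + b"
      using finite_division[OF Q cut, of T] by auto
    have "e - Q * a - b = e - fps_cutoff T e"
      by (simp add: ab(6) algebra_simps)
    moreover have "gauss_le (\<rho> * r) (e - fps_cutoff T e)"
      using T \<rho> e(2) by (auto simp: gauss_le_def)
    ultimately have "gauss_le (\<rho> * r) (e - Q * a - b)"
      by (simp only:)
    then show "\<exists>a\<in>tate. \<exists>b\<in>tate. (\<forall>i\<ge>N. fps_nth b i = 0) \<and> gauss_le r a \<and> gauss_le r b \<and> gauss_le (\<rho> * r) (e - Q * a - b)"
      using ab(3,4,5) by (intro bexI[OF bexI[OF _ ab(2)] ab(1)] conjI) simp_all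
  next
    show "gauss_le \<rho> (f - Q)"
      using f\<rho> \<rho> by (auto simp: Q_def gauss_le_def)
  qed (use \<rho> f Qt tate_add tate_diff tate_mult tate_one tate_limit tate_RX in auto)
  then obtain P h where Ph: "P \<in> tate" "h \<in> tate" "gauss_le \<rho> (P - Q)" "gauss_le \<rho> (h - 1)"
    "\<And>i. i \<ge> N \<Longrightarrow> fps_nth P i = fps_nth Q i" "f = P * h"
    by blast
  obtain q where q: "fps_of_poly q = P" "degree q = N"
    using fps_of_poly_of_bounded_support[of N P] Ph(5) Q by auto
  have cq: "coeff q i = fps_nth P i" for i
    using q(1) by auto
  have "F = fps_const c * f"
    using c(1) by (simp add: f_def mult.assoc[symmetric])
  then have "F = fps_const (fps_nth F N) * fps_of_poly q * h"
    by (simp add: Ph(6) q(1) mult.assoc c_def)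
  moreover have "nrm (fps_nth h i) < 1" if "i > 0" for i
    using near_one_unit(3)[OF tate_RX[OF Ph(2)] Ph(4) \<rho>(2) that] \<rho>(2) by simp
  ultimately show ?thesis
    using q(2) Ph(2) Ph(5)[of N] Q(2) near_one_unit(1)[OF tate_RX[OF Ph(2)] Ph(4) \<rho>(2)] RX_D[OF tate_RX[OF Ph(1)]]
    by (intro exI[of _ q] exI[of _ h]) (simp add: cq)
qed

text \<open>
  As for the open disc, except that the lower coefficients of \<open>P'\<close> may be units. What makes up for it is
  that \<open>1 / h\<close>, and with it \<open>h' / h - 1\<close>, stays in the Tate algebra.
\<close>

lemma weierstrass_c_unique:
  assumes c: "c \<noteq> 0"
    and P: "degree P = N" "lead_coeff P = 1"
    and P': "degree P' = N" "lead_coeff P' = 1" "\<forall>i. coeff P' i \<in> R"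
    and h: "h \<in> tate" "h \<in> units_in RX" "\<And>i. i > 0 \<Longrightarrow> nrm (fps_nth h i) < 1" and h': "h' \<in> tate"
    and eq: "fps_const c * fps_of_poly P * h = fps_const c * fps_of_poly P' * h'"
  shows "P = P'"
proof -
  obtain V where V: "V \<in> RX" "h * V = 1"
    using h(2) unfolding units_in_def by blast
  have "nrm (fps_nth h 0) = 1"
    using units_RX_nth_0[OF h(2)] by (simp add: units_R_iff)
  then have Vt: "V \<in> tate"
    using tate_inverse[OF h(1) V] h(3) by blast
  have "fps_of_poly P * h = fps_of_poly P' * h'"
    using eq c by (simp add: mult.assoc)
  then have "fps_of_poly P * (h * V) = fps_of_poly P' * (h' * V)"
    by (metis mult.assoc)
  then have PV: "fps_of_poly P = fps_of_poly P' * (h' * V)"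
    using V by simp
  have "h' * V - 1 = 0"
  proof (rule monic_quotient_zero[where q = "fps_of_poly P'" and N = N])
    show "h' * V - 1 \<in> tate"
      by (intro tate_diff tate_mult tate_one h' Vt)
    fix i assume "i \<ge> N"
    have "fps_of_poly P' * (h' * V - 1) = fps_of_poly P - fps_of_poly P'"
      by (simp add: PV algebra_simps)
    then show "fps_nth (fps_of_poly P' * (h' * V - 1)) i = 0"
      using \<open>i \<ge> N\<close> P P' by (cases "i = N") (auto simp: coeff_eq_0)
  qed (use P' in \<open>auto simp: coeff_eq_0 RX_iff\<close>)
  then have "fps_of_poly P = fps_of_poly P'"
    using PV by simp
  then show ?thesis by simp
qed

text \<open>
  Minimality of \<open>n\<close> puts the lower coefficients in the maximal ideal, so existence and uniqueness apply
  and the definite description denotes.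
\<close>

lemma weierstrass_o_spec:
  assumes F: "F \<in> RX" "wideg v F = enat n" "fps_nth F n \<in> units_in R"
  shows "degree (weierstrass_o v K F) = n" "lead_coeff (weierstrass_o v K F) = 1"
    "\<exists>U \<in> units_in RX. F = fps_const (fps_nth F n) * fps_of_poly (weierstrass_o v K F) * U"
proof -
  let ?S = "\<lambda>P. wideg v F = enat (degree P) \<and> lead_coeff P = 1 \<and>
     (\<forall>i<degree P. coeff P i \<in> max_ideal_of v K) \<and>
     (\<exists>U \<in> units_in RX. F = fps_const (fps_nth F (degree P)) * fps_of_poly P * U)"
  have n: "n \<in> min_indices v F" "\<And>i. i < n \<Longrightarrow> i \<notin> min_indices v F"
  proof -
    have ne: "min_indices v F \<noteq> {}" and least: "n = (LEAST i. i \<in> min_indices v F)"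
      using F(2) by (auto simp: wideg_def split: if_splits)
    show "n \<in> min_indices v F"
      unfolding least by (rule LeastI_ex) (use ne in blast)
    show "i \<notin> min_indices v F" if "i < n" for i
      using that unfolding least by (rule not_less_Least)
  qed
  have n1: "nrm (fps_nth F n) = 1"
    using F(3) by (simp add: units_R_iff)
  have small: "nrm (fps_nth F i) < 1" if i: "i < n" for i
  proof -
    have "\<not> (\<forall>j. v (fps_nth F i) \<le> v (fps_nth F j))"
      using n(2)[OF i] by (simp add: min_indices_def)
    then obtain j where "\<not> nrm (fps_nth F j) \<le> nrm (fps_nth F i)"
      unfolding nrm_le_iff by blast
    moreover have "nrm (fps_nth F j) \<le> 1"
      using gauss_leD[OF RX_gauss_le[OF F(1)]] .
    ultimately show ?thesis by simp
  qed
  have "\<exists>!P. ?S P"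
  proof (rule ex_ex1I)
    show "\<exists>P. ?S P"
      using weierstrass_o_exists[OF F(1,3) small] F(2) by auto
  next
    fix P P' assume S: "?S P" "?S P'"
    then have d: "degree P = n" "degree P' = n"
      using F(2) by auto
    obtain U U' where "U \<in> units_in RX" "U' \<in> units_in RX"
      "F = fps_const (fps_nth F n) * fps_of_poly P * U" "F = fps_const (fps_nth F n) * fps_of_poly P' * U'"
      using S d by metis
    moreover have "fps_nth F n \<noteq> 0"
      using n1 by auto
    ultimately show "P = P'"
      using weierstrass_o_unique[of "fps_nth F n" P n P' U U'] S d by metis
  qed
  then have "?S (weierstrass_o v K F)"
    unfolding weierstrass_o_def by (rule theI')
  then show "degree (weierstrass_o v K F) = n" "lead_coeff (weierstrass_o v K F) = 1"
    "\<exists>U \<in> units_in RX. F = fps_const (fps_nth F n) * fps_of_poly (weierstrass_o v K F) * U"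
    using F(2) by auto
qed

text \<open>
  The minimal valuation is that of the unit \<open>F\<^sub>n\<close>, so \<open>F\<^sub>N\<close> is a unit as well, and maximality of \<open>N\<close> puts
  the higher coefficients in the maximal ideal.
\<close>

lemma weierstrass_c_spec:
  assumes F: "F \<in> fps_c v K" "Lwideg v F = enat N" and unit: "fps_nth F n \<in> units_in R"
  shows "degree (weierstrass_c v K F) = N" "lead_coeff (weierstrass_c v K F) = 1"
    "\<exists>h \<in> tate. nrm (fps_nth h 0) = 1 \<and> (\<forall>i>0. nrm (fps_nth h i) < 1) \<and> nrm (fps_nth F N) = 1 \<and>
      F = fps_const (fps_nth F N) * fps_of_poly (weierstrass_c v K F) * h"
proof -
  let ?H = "\<lambda>P h. h \<in> fps_c v K \<and>
        fps_nth h 0 \<in> units_in (integers_of v K) \<and>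
        (\<forall>i>0. fps_nth h i \<notin> units_in (integers_of v K)) \<and>
        (\<forall>x \<in> integers_of v UNIV. fps_value h x \<noteq> 0) \<and>
        F = fps_const (fps_nth F (degree P)) * fps_of_poly P * h"
  let ?S = "\<lambda>P. Lwideg v F = enat (degree P) \<and> lead_coeff P = 1 \<and>
     (\<forall>i. coeff P i \<in> integers_of v K) \<and> (\<exists>h \<in> units_in (fps_over (integers_of v K)). ?H P h)"
  have Ft: "F \<in> tate"
    using F(1) fps_c_iff_tate by simp
  have fin: "finite (min_indices v F)" "min_indices v F \<noteq> {}" "N = Max (min_indices v F)"
    using F(2) by (auto simp: Lwideg_def split: if_splits)
  then have N: "N \<in> min_indices v F" "\<And>i. i > N \<Longrightarrow> i \<notin> min_indices v F"
    using Max_in Max_ge by (auto simp: not_le[symmetric])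
  have b: "nrm (fps_nth F i) \<le> 1" for i
    using gauss_leD[OF RX_gauss_le[OF tate_RX[OF Ft]]] .
  have "nrm (fps_nth F n) \<le> nrm (fps_nth F N)"
    using N(1) by (simp add: min_indices_def nrm_le_iff)
  then have N1: "nrm (fps_nth F N) = 1"
    using b[of N] unit by (simp add: units_R_iff)
  then have FN: "fps_nth F N \<in> units_in R" "fps_nth F N \<noteq> 0"
    using RX_D[OF tate_RX[OF Ft], of N] by (auto simp: units_R_iff R_iff)
  have small: "nrm (fps_nth F i) < 1" if i: "i > N" for i
  proof -
    have "\<not> (\<forall>j. v (fps_nth F i) \<le> v (fps_nth F j))"
      using N(2)[OF i] by (simp add: min_indices_def)
    then obtain j where "\<not> nrm (fps_nth F j) \<le> nrm (fps_nth F i)"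
      unfolding nrm_le_iff by blast
    with b[of j] show ?thesis by simp
  qed
  have less1: "nrm (fps_nth h i) < 1" if "h \<in> tate" "\<forall>i>0. fps_nth h i \<notin> units_in R" "i > 0" for h i
  proof -
    have "fps_nth h i \<in> R" "fps_nth h i \<notin> units_in R"
      using RX_D[OF tate_RX[OF that(1)]] that(2,3) by blast+
    then show ?thesis
      by (simp add: units_R_iff R_iff order_less_le)
  qed
  have "\<exists>!P. ?S P"
  proof (rule ex_ex1I)
    obtain P h where Ph: "degree P = N" "lead_coeff P = 1" "\<forall>i. coeff P i \<in> R" "h \<in> tate" "h \<in> units_in RX"
      "\<And>i. i > 0 \<Longrightarrow> nrm (fps_nth h i) < 1" "F = fps_const (fps_nth F N) * fps_of_poly P * h"
      using weierstrass_c_exists[OF Ft FN(1) small] by blast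
    have h0: "fps_nth h 0 \<in> units_in R"
      using units_RX_nth_0[OF Ph(5)] .
    have "fps_value h x \<noteq> 0" if x: "x \<in> integers_of v UNIV" for x
    proof -
      have "nrm x ^ i \<le> 1" for i
        using x by (auto simp: integers_of_def nrm_le_1_iff intro: power_le_one)
      then have "nrm (fps_nth h i * x ^ i) < 1" if "i > 0" for i
        using Ph(6)[OF that] mult_left_mono[of "nrm x ^ i" 1 "nrm (fps_nth h i)"]
        by (simp add: nrm_mult nrm_power)
      moreover obtain s where s: "(\<lambda>i. fps_nth h i * x ^ i) sums s"
        using Ph(4) x unfolding fps_c_iff_tate[symmetric] fps_c_def fps_over_conv_def summable_def by blast
      ultimately have "nrm s = 1"
        using nrm_sums_eq_one[OF s] h0 by (simp add: units_R_iff)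
      moreover have "fps_value h x = s"
        unfolding fps_value_def using s by (rule sums_unique[symmetric])
      ultimately show ?thesis by auto
    qed
    moreover have "\<forall>i>0. fps_nth h i \<notin> units_in R"
      using Ph(6) unfolding units_R_iff by (metis less_irrefl)
    moreover have "h \<in> fps_c v K"
      using Ph(4) fps_c_iff_tate by simp
    ultimately have "?H P h"
      using Ph(1,7) h0 by simp
    then show "\<exists>P. ?S P"
      using Ph(1,2,3,5) F(2) by (intro exI[of _ P]) blast
  next
    fix P P' assume S: "?S P" "?S P'"
    then have d: "degree P = N" "degree P' = N"
      using F(2) by auto
    obtain h where h: "h \<in> units_in RX" "?H P h" using S(1) by blast
    obtain h' where h': "?H P' h'" using S(2) by blast
    have t: "h \<in> tate" "h' \<in> tate"
      using h h' fps_c_iff_tate by auto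
    have "fps_const (fps_nth F N) * fps_of_poly P * h = fps_const (fps_nth F N) * fps_of_poly P' * h'"
      using h(2) h' d by metis
    then show "P = P'"
      using weierstrass_c_unique[OF FN(2) d(1) _ d(2) _ _ t(1) h(1) _ t(2)] S h(2) less1[OF t(1)] by blast
  qed
  then have S: "?S (weierstrass_c v K F)"
    unfolding weierstrass_c_def by (rule theI')
  then show d: "degree (weierstrass_c v K F) = N" and "lead_coeff (weierstrass_c v K F) = 1"
    using F(2) by auto
  obtain h where "?H (weierstrass_c v K F) h"
    using S by blast
  then show "\<exists>h \<in> tate. nrm (fps_nth h 0) = 1 \<and> (\<forall>i>0. nrm (fps_nth h i) < 1) \<and> nrm (fps_nth F N) = 1 \<and>
      F = fps_const (fps_nth F N) * fps_of_poly (weierstrass_c v K F) * h"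
    using N1 less1 d fps_c_iff_tate by (intro bexI[of _ h]) (auto simp: units_R_iff)
qed

section \<open>Smith normal form of the Sylvester matrix\<close>

lemma GL_entries:
  assumes "P \<in> GL_over R k" "i < k" "j < k"
  shows "nrm (P $$ (i, j)) \<le> 1"
  using assms unfolding GL_over_def mat_over_def by (auto simp: R_iff)

lemma mult_mat_vec_small:
  assumes A: "A \<in> carrier_mat k k" "\<And>i j. i < k \<Longrightarrow> j < k \<Longrightarrow> nrm (A $$ (i, j)) \<le> 1"
    and w: "w \<in> carrier_vec k" "\<And>j. j < k \<Longrightarrow> nrm (w $ j) \<le> r" and "0 \<le> r" "i < k"
  shows "nrm ((A *\<^sub>v w) $ i) \<le> r"
proof -
  have "(A *\<^sub>v w) $ i = (\<Sum>j<k. A $$ (i, j) * w $ j)"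
    using A w \<open>i < k\<close> by (auto simp: scalar_prod_def atLeast0LessThan)
  then show ?thesis
    using nrm_mult_le[OF A(2) w(2)] \<open>0 \<le> r\<close> \<open>i < k\<close> by (auto intro!: nrm_sum_le)
qed

text \<open>
  The vector \<open>y = Q\<^sup>-\<^sup>1 w\<close> is integral and primitive, and \<open>D y = P (A w)\<close>. The diagonal entry of \<open>D\<close> at
  an index where \<open>y\<close> has absolute value \<open>1\<close> is thus at most \<open>r\<close> in absolute value, and it divides the
  last one.
\<close>

lemma smith_last_entry_small:
  assumes A: "A \<in> carrier_mat k k" and D: "is_smith_normal_form R A D" and k: "0 < k"
    and w: "w \<in> carrier_vec k" "l < k" "nrm (w $ l) = 1" "\<And>j. j < k \<Longrightarrow> nrm (w $ j) \<le> 1"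
    and Aw: "\<And>j. j < k \<Longrightarrow> nrm ((A *\<^sub>v w) $ j) \<le> r"
  shows "nrm (D $$ (k - 1, k - 1)) \<le> r"
proof -
  have dims: "dim_row A = k" "dim_col A = k" using A by auto
  have r: "0 \<le> r"
    using Aw[OF w(2)] nrm_nonneg order_trans by blast
  obtain P Q where P: "P \<in> GL_over R k" and Q: "Q \<in> GL_over R k" and DPAQ: "D = P * A * Q"
    using D unfolding is_smith_normal_form_def dims by blast
  obtain Q' where Q': "Q' \<in> mat_over R k k" "Q * Q' = 1\<^sub>m k"
    using Q unfolding GL_over_def by blast
  have car: "P \<in> carrier_mat k k" "Q \<in> carrier_mat k k" "Q' \<in> carrier_mat k k" "D \<in> carrier_mat k k"
    using P Q Q' D unfolding GL_over_def mat_over_def is_smith_normal_form_def dims by auto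
  define y where "y = Q' *\<^sub>v w"
  have y: "y \<in> carrier_vec k"
    using car w(1) by (simp add: y_def)
  have "(Q * Q') *\<^sub>v w = Q *\<^sub>v y"
    unfolding y_def by (rule assoc_mult_mat_vec[OF car(2,3) w(1)])
  then have Qy: "Q *\<^sub>v y = w"
    using w(1) by (simp add: Q'(2))
  \<comment> \<open>Otherwise all entries of \<open>w = Q y\<close> would have absolute value below \<open>1\<close>.\<close>
  have "\<exists>i<k. nrm (y $ i) \<ge> 1"
  proof (rule ccontr)
    assume "\<not> ?thesis"
    then obtain \<rho> where \<rho>: "0 < \<rho>" "\<rho> < 1" "\<And>i. i < k \<Longrightarrow> nrm (y $ i) \<le> \<rho>"
      using finite_nrm_less_one[of "{..<k}" "\<lambda>i. nrm (y $ i)"] by (auto simp: not_le)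
    have "nrm ((Q *\<^sub>v y) $ l) \<le> \<rho>"
      using \<rho> y w(2) car GL_entries[OF Q] by (intro mult_mat_vec_small[where k = k]) auto
    with \<rho> w(3) Qy show False by simp
  qed
  then obtain i where i: "i < k" "nrm (y $ i) \<ge> 1" by blast
  have "D *\<^sub>v y = (P * A) *\<^sub>v w"
    unfolding DPAQ Qy[symmetric] by (rule assoc_mult_mat_vec[OF mult_carrier_mat[OF car(1) A] car(2) y])
  also have "\<dots> = P *\<^sub>v (A *\<^sub>v w)"
    by (rule assoc_mult_mat_vec[OF car(1) A w(1)])
  finally have Dy: "D *\<^sub>v y = P *\<^sub>v (A *\<^sub>v w)" .
  have "nrm ((P *\<^sub>v (A *\<^sub>v w)) $ i) \<le> r"
    using car(1) A w(1) by (intro mult_mat_vec_small[OF car(1) GL_entries[OF P] _ Aw r i(1)]) auto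
  moreover have "(D *\<^sub>v y) $ i = (\<Sum>j<k. D $$ (i, j) * y $ j)"
    using car y i by (auto simp: scalar_prod_def atLeast0LessThan)
  moreover have "\<dots> = (\<Sum>j<k. if j = i then D $$ (i, i) * y $ i else 0)"
    using D i car unfolding is_smith_normal_form_def diagonal_mat_def by (intro sum.cong) auto
  ultimately have "nrm (D $$ (i, i)) * nrm (y $ i) \<le> r"
    using i(1) by (simp add: Dy nrm_mult)
  then have "nrm (D $$ (i, i)) \<le> r"
    using mult_left_mono[OF i(2), of "nrm (D $$ (i, i))"] by simp
  moreover have "nrm (D $$ (k - 1, k - 1)) \<le> nrm (D $$ (i, i))"
  proof -
    have step: "nrm (D $$ (Suc j, Suc j)) \<le> nrm (D $$ (j, j))" if j: "Suc j < k" for j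
    proof -
      obtain s where "s \<in> R" "D $$ (Suc j, Suc j) = D $$ (j, j) * s"
        using D j unfolding is_smith_normal_form_def dims min.idem by blast
      then show ?thesis
        by (simp add: nrm_mult R_iff mult_left_le)
    qed
    have "nrm (D $$ (j, j)) \<le> nrm (D $$ (i, i))" if "i \<le> j" "j < k" for j
      using that by (induction j rule: dec_induct) (auto intro: order_trans[OF step])
    then show ?thesis using i(1) by simp
  qed
  ultimately show ?thesis by simp
qed

text \<open>
  A row of the Sylvester matrix lists the coefficients of \<open>X\<^sup>i P\<close> or \<open>X\<^sup>j P'\<close> in decreasing degree, so
  pairing it with the powers of \<open>x\<close> evaluates that polynomial.
\<close>

lemma sylvester_mult_powers:
  fixes P P' :: "'c poly"
  defines "d \<equiv> degree P" and "d' \<equiv> degree P'"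
  assumes i: "i < d + d'"
  shows "(sylvester_mat P P' *\<^sub>v vec (d + d') (\<lambda>j. x ^ (d + d' - 1 - j))) $ i =
    (if i < d' then x ^ (d' - 1 - i) * poly P x else x ^ (d + d' - 1 - i) * poly P' x)"
proof -
  let ?k = "d + d'"
  define g where "g = (if i < d' then Polynomial.monom 1 (d' - 1 - i) * P else Polynomial.monom 1 (?k - 1 - i) * P')"
  have deg: "degree g < ?k"
  proof (cases "i < d'")
    case True
    have "degree g \<le> (d' - 1 - i) + d"
      using True degree_mult_le[of "Polynomial.monom (1::'c) (d' - 1 - i)" P] degree_monom_le[of "1::'c" "d' - 1 - i"]
      by (simp add: g_def d_def)
    with True show ?thesis by simp
  next
    case False
    have "degree g \<le> (?k - 1 - i) + d'"
      using False degree_mult_le[of "Polynomial.monom (1::'c) (?k - 1 - i)" P'] degree_monom_le[of "1::'c" "?k - 1 - i"]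
      by (simp add: g_def d'_def)
    with False i show ?thesis by simp
  qed
  have entry: "sylvester_mat P P' $$ (i, j) = coeff g (?k - 1 - j)" if j: "j < ?k" for j
  proof -
    have "sylvester_mat P P' $$ (i, j) = (if i < d' then coeff (Polynomial.monom 1 (d' - i) * P) (?k - j)
        else coeff (Polynomial.monom 1 (?k - i) * P') (?k - j))"
      using sylvester_index_mat2[of i P P' j] i j by (simp add: d_def d'_def)
    moreover have "coeff (Polynomial.monom 1 (Suc a) * S) (Suc b) = coeff (Polynomial.monom 1 a * S) b"
      for a b and S :: "'c poly"
      by (simp add: monom_Suc)
    moreover have "?k - j = Suc (?k - 1 - j)" "?k - i = Suc (?k - 1 - i)" "i < d' \<Longrightarrow> d' - i = Suc (d' - 1 - i)"
      using i j by auto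
    ultimately show ?thesis
      by (simp add: g_def)
  qed
  have "(sylvester_mat P P' *\<^sub>v vec ?k (\<lambda>j. x ^ (?k - 1 - j))) $ i
      = (\<Sum>j<?k. sylvester_mat P P' $$ (i, j) * x ^ (?k - 1 - j))"
    using i by (auto simp: scalar_prod_def atLeast0LessThan d_def d'_def)
  also have "\<dots> = (\<Sum>j<?k. coeff g (?k - Suc j) * x ^ (?k - Suc j))"
    by (intro sum.cong) (auto simp: entry)
  also have "\<dots> = (\<Sum>j<?k. coeff g j * x ^ j)"
    by (rule sum.nat_diff_reindex)
  also have "\<dots> = poly g x"
    unfolding poly_altdef using deg by (intro sum.mono_neutral_right) (auto simp: coeff_eq_0)
  finally show ?thesis
    by (simp add: g_def poly_monom)
qed

lemma sylvester_smith_bound: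
  assumes P: "lead_coeff P = 1" and D: "is_smith_normal_form R (sylvester_mat P P') D"
    and x: "nrm x \<le> 1"
  shows "min (v (poly P x)) (v (poly P' x)) \<le> v (diag_entry D (degree P + degree P'))"
proof (cases "degree P + degree P' = 0")
  case True
  \<comment> \<open>The Sylvester matrix is empty, and the bound reads \<open>min 0 _ \<le> v 1\<close>.\<close>
  then obtain a where "P = [:a:]"
    using degree_eq_zeroE[of P] by auto
  with P have "P = 1"
    by (simp add: one_pCons)
  then show ?thesis
    using True by (simp add: diag_entry_def)
next
  case False
  let ?k = "degree P + degree P'" and ?r = "max (nrm (poly P x)) (nrm (poly P' x))"
  have pow: "nrm (x ^ i) \<le> 1" for i
    using x by (simp add: nrm_power power_le_one)
  have "nrm (D $$ (?k - 1, ?k - 1)) \<le> ?r"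
  proof (rule smith_last_entry_small[OF _ D, where l = "?k - 1" and w = "vec ?k (\<lambda>j. x ^ (?k - 1 - j))"])
    fix j assume j: "j < ?k"
    have "nrm (x ^ i * poly P x) \<le> ?r" "nrm (x ^ i * poly P' x) \<le> ?r" for i
      using nrm_mult_le[OF pow order_refl, of i "poly P x"] nrm_mult_le[OF pow order_refl, of i "poly P' x"]
      by auto
    then show "nrm ((sylvester_mat P P' *\<^sub>v vec ?k (\<lambda>j. x ^ (?k - 1 - j))) $ j) \<le> ?r"
      unfolding sylvester_mult_powers[OF j] by simp
  qed (use False pow in \<open>auto simp: sylvester_carrier_mat\<close>)
  then have "nrm (D $$ (?k - 1, ?k - 1)) \<le> nrm (poly P x) \<or> nrm (D $$ (?k - 1, ?k - 1)) \<le> nrm (poly P' x)"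
    by auto
  then show ?thesis
    using False unfolding nrm_le_iff diag_entry_def by (auto simp: min_le_iff_disj)
qed

section \<open>Values on the open and the closed disc\<close>

text \<open>
  Integral coefficients suffice here, since the powers of \<open>x\<close> tend to zero by themselves. On the closed disc
  the coefficients of \<open>h\<close> have to do this.
\<close>

lemma v_value_open_disc:
  assumes F: "F \<in> RX" "wideg v F = enat n" "fps_nth F n \<in> units_in R" and x: "nrm x < 1"
  shows "v (fps_value F x) = v (poly (weierstrass_o v K F) x)"
proof -
  obtain U where U: "U \<in> units_in RX" and eq: "F = fps_const (fps_nth F n) * fps_of_poly (weierstrass_o v K F) * U"
    using weierstrass_o_spec(3)[OF F] by blast
  have URX: "U \<in> RX"
    using U by (simp add: units_in_def)
  have term_le: "nrm (fps_nth U i * x ^ i) \<le> nrm x ^ i" for i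
    using nrm_mult_le[OF gauss_leD[OF RX_gauss_le[OF URX]], of "x ^ i" "nrm x ^ i" i] by (simp add: nrm_power)
  have "v (fps_value (fps_const (fps_nth F n) * fps_of_poly (weierstrass_o v K F) * U) x)
      = v (poly (weierstrass_o v K F) x)"
  proof (rule v_value_eq_v_poly)
    fix r :: real assume "r > 0"
    then obtain M where M: "nrm x ^ M < r"
      using real_arch_pow_inv[OF _ x] by blast
    have "nrm (fps_nth U i * x ^ i) \<le> r" if "i \<ge> M" for i
      using term_le[of i] M power_decreasing[OF that, of "nrm x"] x by simp
    then show "\<exists>M. \<forall>i\<ge>M. nrm (fps_nth U i * x ^ i) \<le> r" by blast
  next
    fix i :: nat assume "i > 0"
    then show "nrm (fps_nth U i * x ^ i) < 1"
      using term_le[of i] power_less_one_iff[of "nrm x" i] x by simp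
  qed (use F(3) units_RX_nth_0[OF U] in \<open>auto simp: units_R_iff\<close>)
  then show ?thesis
    using eq by simp
qed

lemma v_value_closed_disc:
  assumes F: "F \<in> fps_c v K" "Lwideg v F = enat N" "fps_nth F n \<in> units_in R" and x: "nrm x \<le> 1"
  shows "v (fps_value F x) = v (poly (weierstrass_c v K F) x)"
proof -
  obtain h where h: "h \<in> tate" "nrm (fps_nth h 0) = 1" "\<And>i. i > 0 \<Longrightarrow> nrm (fps_nth h i) < 1"
    and FN: "nrm (fps_nth F N) = 1"
    and eq: "F = fps_const (fps_nth F N) * fps_of_poly (weierstrass_c v K F) * h"
    using weierstrass_c_spec(3)[OF F] by blast
  have term_le: "nrm (fps_nth h i * x ^ i) \<le> nrm (fps_nth h i)" for i
    using nrm_mult_le[OF order_refl, of "x ^ i" 1 "fps_nth h i"] x by (simp add: nrm_power power_le_one)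
  have "v (fps_value (fps_const (fps_nth F N) * fps_of_poly (weierstrass_c v K F) * h) x)
      = v (poly (weierstrass_c v K F) x)"
  proof (rule v_value_eq_v_poly[OF FN _ h(2)])
    fix r :: real assume "r > 0"
    then show "\<exists>M. \<forall>i\<ge>M. nrm (fps_nth h i * x ^ i) \<le> r"
      using tateD[OF h(1)] term_le order_trans by meson
  next
    fix i :: nat assume "i > 0"
    then show "nrm (fps_nth h i * x ^ i) < 1"
      using term_le[of i] h(3)[of i] by simp
  qed
  then show ?thesis
    using eq by simp
qed

end

theorem corollary3p1:
  fixes p :: nat
    and v :: "'c::{field_char_0, complete_space} \<Rightarrow> ereal"
    and K :: "'c set"
    and F G :: "'c fps"
    and n m :: nat
  assumes "padic_complex_field p v"
    and "finite_extension_Qp K"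
    and "F \<in> fps_over (integers_of v K)"
    and "G \<in> fps_over (integers_of v K)"
    and "wideg v F = enat n"
    and "wideg v G = enat m"
    and "fps_nth F n \<in> units_in (integers_of v K)"
    and "fps_nth G m \<in> units_in (integers_of v K)"
  shows "(F \<in> fps_o v K \<longrightarrow> G \<in> fps_o v K \<longrightarrow>
            (\<forall>D. is_smith_normal_form (integers_of v K)
                   (sylvester_mat (weierstrass_o v K F) (weierstrass_o v K G)) D \<longrightarrow>
               (SUP x \<in> max_ideal_of v UNIV. phi v F G x) \<le> v (diag_entry D (n + m)))) \<and>
         (\<forall>N M. F \<in> fps_c v K \<longrightarrow> G \<in> fps_c v K \<longrightarrow>
            Lwideg v F = enat N \<longrightarrow> Lwideg v G = enat M \<longrightarrow>
            (\<forall>D. is_smith_normal_form (integers_of v K)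
                   (sylvester_mat (weierstrass_c v K F) (weierstrass_c v K G)) D \<longrightarrow>
               (SUP x \<in> integers_of v UNIV. phi v F G x) \<le> v (diag_entry D (N + M))))"
proof -
  interpret padic_finite_extension p v K
    using assms(1,2) by (intro padic_finite_extension.intro padic_finite_extension_axioms.intro)
  show ?thesis
  proof (intro conjI allI impI SUP_least)
    fix D x
    assume D: "is_smith_normal_form (integers_of v K) (sylvester_mat (weierstrass_o v K F) (weierstrass_o v K G)) D"
      and "x \<in> max_ideal_of v UNIV"
    then have x: "nrm x < 1"
      by (simp add: max_ideal_of_def nrm_less_1_iff)
    note F = assms(3,5,7) and G = assms(4,6,8)
    show "phi v F G x \<le> v (diag_entry D (n + m))"
      using sylvester_smith_bound[OF weierstrass_o_spec(2)[OF F] D less_imp_le[OF x]]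
      unfolding phi_def v_value_open_disc[OF F x] v_value_open_disc[OF G x]
        weierstrass_o_spec(1)[OF F] weierstrass_o_spec(1)[OF G] .
  next
    fix N M D x
    assume F: "F \<in> fps_c v K" "Lwideg v F = enat N" and G: "G \<in> fps_c v K" "Lwideg v G = enat M"
      and D: "is_smith_normal_form (integers_of v K) (sylvester_mat (weierstrass_c v K F) (weierstrass_c v K G)) D"
      and "x \<in> integers_of v UNIV"
    then have x: "nrm x \<le> 1"
      by (simp add: integers_of_def nrm_le_1_iff)
    note F = F assms(7) and G = G assms(8)
    show "phi v F G x \<le> v (diag_entry D (N + M))"
      using sylvester_smith_bound[OF weierstrass_c_spec(2)[OF F] D x]
      unfolding phi_def v_value_closed_disc[OF F x] v_value_closed_disc[OF G x]
        weierstrass_c_spec(1)[OF F] weierstrass_c_spec(1)[OF G] .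
  qed
qed

end
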